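(* Let $\omega_1,\omega_2\in\mathbf{C}\setminus\{0\}$ with $\Im(\omega_2/\omega_1)>0$, and let $\Lambda=\mathbf{Z}2\omega_1+\mathbf{Z}2\omega_2$. (i) Let $\delta$ be a positive divisor on $\mathbf{C}/\Lambda$. Then there exists a uniformly periodic linear system with tau function $\tau$, where $\tau$ is elliptic of the third kind with zero divisor $\delta$. (ii) Let $\eta$ be a divisor on $\mathbf{C}/\Lambda$ of degree zero. Then there exists a pair of uniformly periodic linear systems with tau functions $\tau_0$ and $\tau_1$ such that $\tau_1/\tau_0$ is elliptic of the second kind with $\eta$ the divisor of its poles and zeros. (iii) Let $\gamma=\sum_{j=1}^n\delta_{a_j}-\sum_{j=1}^n\delta_{b_j}$ be a divisor of degree zero, where $\sum_{j=1}^n(a_j-b_j)\in\Lambda$. Then there exists a pair of uniformly periodic linear systems with tau functions $\tau_1$ and $\tau_0$ such that $\tau_1/\tau_0$ is elliptic of the first kind with $\gamma$ the divisor of the poles and zeros.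
   Context: Uniformly periodic linear system: $A\in\mathcal{L}(H)$ is such that $(e^{xA})_{x\in\mathbf{R}}$ is a periodic group on the Hilbert space $H$, and $B\in\mathcal{L}(H_0,H)$, $C\in\mathcal{L}(H,H_0)$ (with $H_0$ a Hilbert space) satisfy $AE+EA=BC$ for some trace class operator $E$ on $H$; then $(-A,B,C;E)$ is a uniformly periodic linear system and $\tau(x)=\det(I+e^{xA}Ee^{xA})$ is its tau function (an entire function of $x$). Elliptic functions for the lattice $\Lambda=\mathbf{Z}2\omega_1+\mathbf{Z}2\omega_2$: a meromorphic function $f$ on $\mathbf{C}$ is elliptic of the first kind if it is doubly periodic with respect to $\Lambda$; of the second kind if there exist multipliers $\rho_j\in\mathbf{C}$ with $f(z+2\omega_j)=\rho_jf(z)$ $(j=1,2)$; of the third kind if there exist $a_j,b_j\in\mathbf{C}$ with $f(z+2\omega_j)=e^{a_jz+b_j}f(z)$ $(j=1,2)$. A divisor on $\mathbf{C}/\Lambda$ is a finite integer combination of points, where $\delta_a$ denotes the point $a$ with coefficient one; it is positive if all its coefficients are nonnegative, and its degree is the sum of its coefficients.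
   Formalization: The period of the group e^{xA} is real if Λ contains a nonzero real number; otherwise only a nonzero complex period is required, because a real period T would force a multiple of T into Λ for any nonzero divisor, making the claim false as printed. *)

theory Defs
  imports "HOL-Complex_Analysis.Complex_Analysis" "HOL-Library.Poly_Mapping"
begin

section \<open>Complex Hilbert spaces\<close>

text \<open>The inner product is linear in its second argument.\<close>

class complex_hilbert = banach +
  fixes scaleC :: "complex \<Rightarrow> 'a \<Rightarrow> 'a"  (infixr \<open>*\<^sub>C\<close> 75)
    and cinner :: "'a \<Rightarrow> 'a \<Rightarrow> complex"
  assumes scaleC_add_right: "c *\<^sub>C (x + y) = c *\<^sub>C x + c *\<^sub>C y"
    and scaleC_add_left: "(c + d) *\<^sub>C x = c *\<^sub>C x + d *\<^sub>C x"
    and scaleC_scaleC: "c *\<^sub>C d *\<^sub>C x = (c * d) *\<^sub>C x"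
    and scaleC_of_real: "complex_of_real r *\<^sub>C x = r *\<^sub>R x"
    and cinner_commute: "cinner x y = cnj (cinner y x)"
    and cinner_add_right: "cinner x (y + z) = cinner x y + cinner x z"
    and cinner_scaleC_right: "cinner x (c *\<^sub>C y) = c * cinner x y"
    and norm_eq_sqrt_cinner: "norm x = sqrt (Re (cinner x x))"

definition bounded_clinear :: "('a::complex_hilbert \<Rightarrow> 'b::complex_hilbert) \<Rightarrow> bool" where
  "bounded_clinear T \<longleftrightarrow> bounded_linear T \<and> (\<forall>c x. T (c *\<^sub>C x) = c *\<^sub>C T x)"

definition orthonormal_basis :: "'a::complex_hilbert set \<Rightarrow> bool" where
  "orthonormal_basis S \<longleftrightarrow>
     (\<forall>e\<in>S. \<forall>f\<in>S. cinner e f = (if e = f then 1 else 0)) \<and>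
     (\<forall>x. (\<forall>e\<in>S. cinner e x = 0) \<longrightarrow> x = 0)"

text \<open>\<^term>\<open>P\<close> is the modulus \<open>|T| = (T\<^sup>* T)\<^sup>1\<^sup>/\<^sup>2\<close>: since a positive operator is
  self-adjoint, the last clause says \<open>P\<^sup>2 = T\<^sup>* T\<close>. The positive square root exists and is unique.\<close>

definition is_modulus :: "('a::complex_hilbert \<Rightarrow> 'a) \<Rightarrow> ('a \<Rightarrow> 'a) \<Rightarrow> bool" where
  "is_modulus P T \<longleftrightarrow>
     bounded_clinear P \<and> (\<forall>x. cinner x (P x) \<in> \<real>\<^sub>\<ge>\<^sub>0) \<and>
     (\<forall>x y. cinner (P x) (P y) = cinner (T x) (T y))"

text \<open>The sum \<open>\<Sum>\<langle>e, |T| e\<rangle>\<close> does not depend on the orthonormal basis.\<close>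

definition trace_class :: "('a::complex_hilbert \<Rightarrow> 'a) \<Rightarrow> bool" where
  "trace_class T \<longleftrightarrow>
     bounded_clinear T \<and>
     (\<exists>P S. is_modulus P T \<and> orthonormal_basis S \<and> (\<lambda>e. Re (cinner e (P e))) summable_on S)"

definition eigenvalue :: "('a::complex_hilbert \<Rightarrow> 'a) \<Rightarrow> complex \<Rightarrow> bool" where
  "eigenvalue T \<mu> \<longleftrightarrow> (\<exists>x. x \<noteq> 0 \<and> T x = \<mu> *\<^sub>C x)"

text \<open>Algebraic multiplicity: the complex dimension of the generalized eigenspace.\<close>

definition alg_mult :: "('a::complex_hilbert \<Rightarrow> 'a) \<Rightarrow> complex \<Rightarrow> nat" where
  "alg_mult T \<mu> =
     vector_space.dim scaleC {x. \<exists>k. ((\<lambda>y. T y - \<mu> *\<^sub>C y) ^^ k) x = 0}"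

text \<open>\<open>det (I + T)\<close> for trace class \<^term>\<open>T\<close>: the (unconditionally convergent) product of
  \<open>1 + \<mu>\<close> over the nonzero eigenvalues \<open>\<mu>\<close> of \<^term>\<open>T\<close>, repeated according to
  algebraic multiplicity.\<close>

definition fredholm_det :: "('a::complex_hilbert \<Rightarrow> 'a) \<Rightarrow> complex" where
  "fredholm_det T =
     Lim (finite_subsets_at_top {\<mu>. \<mu> \<noteq> 0 \<and> eigenvalue T \<mu>})
       (\<lambda>F. \<Prod>\<mu>\<in>F. (1 + \<mu>) ^ alg_mult T \<mu>)"

definition exp_op :: "complex \<Rightarrow> ('a::complex_hilbert \<Rightarrow> 'a) \<Rightarrow> 'a \<Rightarrow> 'a" where
  "exp_op z A x = suminf (\<lambda>n. (z ^ n / fact n) *\<^sub>C (A ^^ n) x)"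


section \<open>The Hilbert space of square summable sequences\<close>

text \<open>Existence of linear systems is asserted on this space.\<close>

typedef ell2 = "{f :: nat \<Rightarrow> complex. summable (\<lambda>n. (cmod (f n))\<^sup>2)}"
  morphisms ell2_nth Abs_ell2
  by (rule exI[of _ "\<lambda>_. 0"]) simp

setup_lifting type_definition_ell2

lemma ell2_summable: "summable (\<lambda>n. (cmod (ell2_nth f n))\<^sup>2)"
  using ell2_nth[of f] by simp

lemma ell2_add_summable:
  fixes f g :: "nat \<Rightarrow> complex"
  assumes "summable (\<lambda>n. (cmod (f n))\<^sup>2)" "summable (\<lambda>n. (cmod (g n))\<^sup>2)"
  shows "summable (\<lambda>n. (cmod (f n + g n))\<^sup>2)"
proof (rule summable_comparison_test_ev)
  show "summable (\<lambda>n. 2 * (cmod (f n))\<^sup>2 + 2 * (cmod (g n))\<^sup>2)"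
    by (intro summable_add summable_mult assms)
  have "(cmod (f n + g n))\<^sup>2 \<le> 2 * (cmod (f n))\<^sup>2 + 2 * (cmod (g n))\<^sup>2" for n
  proof -
    have "(cmod (f n + g n))\<^sup>2 \<le> (cmod (f n) + cmod (g n))\<^sup>2"
      by (intro power_mono norm_triangle_ineq) auto
    also have "\<dots> \<le> 2 * (cmod (f n))\<^sup>2 + 2 * (cmod (g n))\<^sup>2"
      using zero_le_power2[of "cmod (f n) - cmod (g n)"]
      by (simp add: power2_eq_square algebra_simps)
    finally show ?thesis .
  qed
  then show "\<forall>\<^sub>F n in sequentially.
      norm ((cmod (f n + g n))\<^sup>2) \<le> 2 * (cmod (f n))\<^sup>2 + 2 * (cmod (g n))\<^sup>2"
    by simp
qed

lemma ell2_mult_summable: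
  fixes f g :: "nat \<Rightarrow> complex"
  assumes "summable (\<lambda>n. (cmod (f n))\<^sup>2)" "summable (\<lambda>n. (cmod (g n))\<^sup>2)"
  shows "summable (\<lambda>n. cnj (f n) * g n)"
proof (rule summable_comparison_test_ev)
  show "summable (\<lambda>n. (cmod (f n))\<^sup>2 + (cmod (g n))\<^sup>2)"
    by (intro summable_add assms)
  have "norm (cnj (f n) * g n) \<le> (cmod (f n))\<^sup>2 + (cmod (g n))\<^sup>2" for n
  proof -
    have "2 * (cmod (f n) * cmod (g n)) \<le> (cmod (f n))\<^sup>2 + (cmod (g n))\<^sup>2"
      using sum_squares_bound[of "cmod (f n)" "cmod (g n)"] by (simp add: mult.assoc)
    moreover have "0 \<le> cmod (f n) * cmod (g n)" by simp
    ultimately show ?thesis unfolding norm_mult complex_mod_cnj by linarith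
  qed
  then show "\<forall>\<^sub>F n in sequentially. norm (cnj (f n) * g n) \<le> (cmod (f n))\<^sup>2 + (cmod (g n))\<^sup>2"
    by simp
qed

instantiation ell2 :: real_normed_vector
begin

lift_definition zero_ell2 :: ell2 is "\<lambda>_. 0" by simp
lift_definition plus_ell2 :: "ell2 \<Rightarrow> ell2 \<Rightarrow> ell2" is "\<lambda>f g n. f n + g n"
  by (rule ell2_add_summable)
lift_definition uminus_ell2 :: "ell2 \<Rightarrow> ell2" is "\<lambda>f n. - f n" by simp
lift_definition minus_ell2 :: "ell2 \<Rightarrow> ell2 \<Rightarrow> ell2" is "\<lambda>f g n. f n - g n"
proof -
  fix f g :: "nat \<Rightarrow> complex"
  assume "summable (\<lambda>n. (cmod (f n))\<^sup>2)" "summable (\<lambda>n. (cmod (g n))\<^sup>2)"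
  then show "summable (\<lambda>n. (cmod (f n - g n))\<^sup>2)"
    using ell2_add_summable[of f "\<lambda>n. - g n"] by simp
qed
lift_definition scaleR_ell2 :: "real \<Rightarrow> ell2 \<Rightarrow> ell2" is "\<lambda>r f n. of_real r * f n"
  by (simp add: norm_mult power_mult_distrib summable_mult)
lift_definition norm_ell2 :: "ell2 \<Rightarrow> real" is "\<lambda>f. sqrt (suminf (\<lambda>n. (cmod (f n))\<^sup>2))" .

definition sgn_ell2 :: "ell2 \<Rightarrow> ell2" where "sgn_ell2 f = inverse (norm f) *\<^sub>R f"
definition dist_ell2 :: "ell2 \<Rightarrow> ell2 \<Rightarrow> real" where "dist_ell2 f g = norm (f - g)"
definition uniformity_ell2 :: "(ell2 \<times> ell2) filter"
  where "uniformity_ell2 = (INF e\<in>{0<..}. principal {(x, y). dist x y < e})"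
definition open_ell2 :: "ell2 set \<Rightarrow> bool"
  where "open_ell2 U \<longleftrightarrow> (\<forall>x\<in>U. \<forall>\<^sub>F (x', y) in uniformity. x' = x \<longrightarrow> y \<in> U)"

lemma L2_set_le_norm_ell2:
  assumes "finite I"
  shows "L2_set (\<lambda>n. cmod (ell2_nth f n)) I \<le> norm f"
  unfolding L2_set_def norm_ell2.rep_eq
  by (intro real_sqrt_le_mono sum_le_suminf ell2_summable assms) auto

lemma norm_ell2_leI:
  assumes "\<And>N. L2_set (\<lambda>n. cmod (ell2_nth f n)) {..<N} \<le> B"
  shows "norm f \<le> B"
proof -
  have "0 \<le> B" using assms[of 0] by simp
  have "(\<Sum>n<N. (cmod (ell2_nth f n))\<^sup>2) \<le> B\<^sup>2" for N
    using assms[of N] \<open>0 \<le> B\<close> by (simp add: L2_set_def real_sqrt_le_iff' sum_nonneg)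
  then have "suminf (\<lambda>n. (cmod (ell2_nth f n))\<^sup>2) \<le> B\<^sup>2"
    by (intro suminf_le_const ell2_summable) auto
  then show ?thesis
    using \<open>0 \<le> B\<close> by (simp add: norm_ell2.rep_eq real_le_lsqrt suminf_nonneg ell2_summable)
qed

instance
proof
  fix f g h :: ell2 and r s :: real
  show "f + g + h = f + (g + h)" by transfer (simp add: add.assoc)
  show "f + g = g + f" by transfer (simp add: add.commute)
  show "0 + f = f" by transfer simp
  show "- f + f = 0" by transfer simp
  show "f - g = f + - g" by transfer simp
  show "r *\<^sub>R (f + g) = r *\<^sub>R f + r *\<^sub>R g" by transfer (simp add: algebra_simps)
  show "(r + s) *\<^sub>R f = r *\<^sub>R f + s *\<^sub>R f" by transfer (simp add: algebra_simps)
  show "r *\<^sub>R s *\<^sub>R f = (r * s) *\<^sub>R f" by transfer (simp add: algebra_simps)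
  show "1 *\<^sub>R f = f" by transfer simp
  show "sgn f = inverse (norm f) *\<^sub>R f" by (rule sgn_ell2_def)
  show "dist f g = norm (f - g)" by (rule dist_ell2_def)
  show "(uniformity :: (ell2 \<times> ell2) filter) = (INF e\<in>{0<..}. principal {(x, y). dist x y < e})"
    by (rule uniformity_ell2_def)
  show "open U \<longleftrightarrow> (\<forall>x\<in>U. \<forall>\<^sub>F (x', y) in uniformity. x' = x \<longrightarrow> y \<in> U)" for U :: "ell2 set"
    by (rule open_ell2_def)
  show "norm f = 0 \<longleftrightarrow> f = 0"
  proof
    assume "norm f = 0"
    then have "L2_set (\<lambda>n. cmod (ell2_nth f n)) {n} \<le> 0" for n
      using L2_set_le_norm_ell2[of "{n}" f] by simp
    then have "ell2_nth f n = 0" for n by (simp add: L2_set_def)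
    then show "f = 0" by (simp add: ell2_nth_inject[symmetric] zero_ell2.rep_eq fun_eq_iff)
  qed (simp add: norm_ell2.rep_eq zero_ell2.rep_eq)
  show "norm (f + g) \<le> norm f + norm g"
  proof (rule norm_ell2_leI)
    fix N :: nat
    have "L2_set (\<lambda>n. cmod (ell2_nth (f + g) n)) {..<N} \<le>
          L2_set (\<lambda>n. cmod (ell2_nth f n) + cmod (ell2_nth g n)) {..<N}"
      by (intro L2_set_mono) (auto simp: plus_ell2.rep_eq norm_triangle_ineq)
    also have "\<dots> \<le> L2_set (\<lambda>n. cmod (ell2_nth f n)) {..<N} + L2_set (\<lambda>n. cmod (ell2_nth g n)) {..<N}"
      by (rule L2_set_triangle_ineq)
    also have "\<dots> \<le> norm f + norm g"
      by (intro add_mono L2_set_le_norm_ell2) auto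
    finally show "L2_set (\<lambda>n. cmod (ell2_nth (f + g) n)) {..<N} \<le> norm f + norm g" .
  qed
  show "norm (r *\<^sub>R f) = \<bar>r\<bar> * norm f"
    by (simp add: norm_ell2.rep_eq scaleR_ell2.rep_eq norm_mult power_mult_distrib
        suminf_mult ell2_summable real_sqrt_mult)
qed

end

lemma cmod_ell2_nth_le: "cmod (ell2_nth f n) \<le> norm f"
  using L2_set_le_norm_ell2[of "{n}" f] by (simp add: L2_set_def)

instance ell2 :: banach
proof
  fix X :: "nat \<Rightarrow> ell2"
  assume X: "Cauchy X"
  have "Cauchy (\<lambda>k. ell2_nth (X k) n)" for n
  proof (rule metric_CauchyI)
    fix e :: real assume "e > 0"
    then obtain M where "\<forall>m\<ge>M. \<forall>k\<ge>M. dist (X m) (X k) < e"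
      using X by (auto simp: Cauchy_def)
    moreover have "dist (ell2_nth (X m) n) (ell2_nth (X k) n) \<le> dist (X m) (X k)" for m k
      using cmod_ell2_nth_le[of "X m - X k" n] by (simp add: dist_norm minus_ell2.rep_eq)
    ultimately show "\<exists>M. \<forall>m\<ge>M. \<forall>k\<ge>M. dist (ell2_nth (X m) n) (ell2_nth (X k) n) < e"
      by (meson le_less_trans)
  qed
  then have "\<exists>l. (\<lambda>k. ell2_nth (X k) n) \<longlonglongrightarrow> l" for n
    using Cauchy_convergent convergent_def by blast
  then obtain f where f: "(\<lambda>k. ell2_nth (X k) n) \<longlonglongrightarrow> f n" for n
    by metis
  have tail: "L2_set (\<lambda>n. cmod (ell2_nth (X m) n - f n)) {..<N} \<le> e"
    if M: "\<forall>m\<ge>M. \<forall>k\<ge>M. dist (X m) (X k) < e" and "m \<ge> M" for e M m N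
  proof (rule tendsto_upperbound)
    show "(\<lambda>k. L2_set (\<lambda>n. cmod (ell2_nth (X m) n - ell2_nth (X k) n)) {..<N})
            \<longlonglongrightarrow> L2_set (\<lambda>n. cmod (ell2_nth (X m) n - f n)) {..<N}"
      unfolding L2_set_def by (intro tendsto_intros f)
    have "L2_set (\<lambda>n. cmod (ell2_nth (X m) n - ell2_nth (X k) n)) {..<N} \<le> e" if "k \<ge> M" for k
    proof -
      have "L2_set (\<lambda>n. cmod (ell2_nth (X m) n - ell2_nth (X k) n)) {..<N} \<le> dist (X m) (X k)"
        using L2_set_le_norm_ell2[of "{..<N}" "X m - X k"]
        by (simp add: dist_norm minus_ell2.rep_eq)
      also have "\<dots> \<le> e" using M \<open>m \<ge> M\<close> that by (meson less_imp_le)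
      finally show ?thesis .
    qed
    then show "\<forall>\<^sub>F k in sequentially.
        L2_set (\<lambda>n. cmod (ell2_nth (X m) n - ell2_nth (X k) n)) {..<N} \<le> e"
      using eventually_sequentially by blast
  qed auto
  obtain M1 where M1: "\<forall>m\<ge>M1. \<forall>k\<ge>M1. dist (X m) (X k) < 1"
    using X zero_less_one unfolding Cauchy_def by metis
  have "summable (\<lambda>n. (cmod (ell2_nth (X M1) n - f n))\<^sup>2)"
  proof (rule bounded_imp_summable)
    show "(\<Sum>n\<le>N. (cmod (ell2_nth (X M1) n - f n))\<^sup>2) \<le> 1" for N
    proof -
      have "sqrt (\<Sum>n<Suc N. (cmod (ell2_nth (X M1) n - f n))\<^sup>2) \<le> 1"
        using tail[OF M1, of M1 "Suc N"] by (simp add: L2_set_def)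
      then show ?thesis by (simp add: lessThan_Suc_atMost)
    qed
  qed auto
  then have "summable (\<lambda>n. (cmod (f n - ell2_nth (X M1) n))\<^sup>2)"
    by (simp add: norm_minus_commute)
  from ell2_add_summable[OF this ell2_summable[of "X M1"]]
  have "summable (\<lambda>n. (cmod (f n))\<^sup>2)" by simp
  then have F: "ell2_nth (Abs_ell2 f) = f" by (simp add: Abs_ell2_inverse)
  have "X \<longlonglongrightarrow> Abs_ell2 f"
  proof (rule metric_LIMSEQ_I)
    fix e :: real assume "e > 0"
    then obtain M where M: "\<forall>m\<ge>M. \<forall>k\<ge>M. dist (X m) (X k) < e / 2"
      using X by (metis Cauchy_def half_gt_zero)
    have "dist (X m) (Abs_ell2 f) \<le> e / 2" if "m \<ge> M" for m
      unfolding dist_norm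
      by (rule norm_ell2_leI) (use tail[OF M that] in \<open>simp add: minus_ell2.rep_eq F\<close>)
    then show "\<exists>M. \<forall>m\<ge>M. dist (X m) (Abs_ell2 f) < e"
      using \<open>e > 0\<close> by (intro exI[of _ M]) fastforce
  qed
  then show "convergent X" by (auto simp: convergent_def)
qed

instantiation ell2 :: complex_hilbert
begin

lift_definition scaleC_ell2 :: "complex \<Rightarrow> ell2 \<Rightarrow> ell2" is "\<lambda>c f n. c * f n"
  by (simp add: norm_mult power_mult_distrib summable_mult)
lift_definition cinner_ell2 :: "ell2 \<Rightarrow> ell2 \<Rightarrow> complex" is "\<lambda>f g. suminf (\<lambda>n. cnj (f n) * g n)" .

instance
proof
  fix f g h :: ell2 and c d :: complex and r :: real
  show "c *\<^sub>C (f + g) = c *\<^sub>C f + c *\<^sub>C g" by transfer (simp add: algebra_simps)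
  show "(c + d) *\<^sub>C f = c *\<^sub>C f + d *\<^sub>C f" by transfer (simp add: algebra_simps)
  show "c *\<^sub>C d *\<^sub>C f = (c * d) *\<^sub>C f" by transfer (simp add: algebra_simps)
  show "complex_of_real r *\<^sub>C f = r *\<^sub>R f" by transfer simp
  have sums: "summable (\<lambda>n. cnj (ell2_nth f n) * ell2_nth g n)" for f g
    by (intro ell2_mult_summable ell2_summable)
  have "(\<lambda>n. cnj (cnj (ell2_nth g n) * ell2_nth f n)) sums cnj (cinner g f)"
    unfolding sums_cnj cinner_ell2.rep_eq by (rule summable_sums[OF sums])
  then show "cinner f g = cnj (cinner g f)"
    by (simp add: cinner_ell2.rep_eq mult.commute sums_iff)
  show "cinner f (g + h) = cinner f g + cinner f h"
    by (simp add: cinner_ell2.rep_eq plus_ell2.rep_eq distrib_left suminf_add sums)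
  show "cinner f (c *\<^sub>C g) = c * cinner f g"
    by (simp add: cinner_ell2.rep_eq scaleC_ell2.rep_eq mult.left_commute suminf_mult sums)
  have "(\<lambda>n. Re (cnj (ell2_nth f n) * ell2_nth f n)) sums Re (cinner f f)"
    unfolding cinner_ell2.rep_eq by (intro sums_Re summable_sums sums)
  moreover have "Re (cnj z * z) = (cmod z)\<^sup>2" for z
    unfolding cmod_power2 by (simp add: power2_eq_square)
  ultimately show "norm f = sqrt (Re (cinner f f))"
    by (simp add: norm_ell2.rep_eq sums_iff)
qed

end


section \<open>Lattices, divisors and elliptic functions\<close>

text \<open>\<^term>\<open>\<omega>\<^sub>1\<close> and \<^term>\<open>\<omega>\<^sub>2\<close> are half periods.\<close>

definition period_lattice :: "complex \<Rightarrow> complex \<Rightarrow> complex set" where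
  "period_lattice \<omega>\<^sub>1 \<omega>\<^sub>2 = {of_int m * (2 * \<omega>\<^sub>1) + of_int n * (2 * \<omega>\<^sub>2) | m n. True}"

definition torus_point :: "complex set \<Rightarrow> complex \<Rightarrow> complex set" where
  "torus_point \<Lambda> z = {z + l | l. l \<in> \<Lambda>}"

definition divisor_on :: "complex set \<Rightarrow> (complex set \<Rightarrow>\<^sub>0 int) \<Rightarrow> bool" where
  "divisor_on \<Lambda> D \<longleftrightarrow> Poly_Mapping.keys D \<subseteq> range (torus_point \<Lambda>)"

definition positive_divisor :: "(complex set \<Rightarrow>\<^sub>0 int) \<Rightarrow> bool" where
  "positive_divisor D \<longleftrightarrow> (\<forall>p. 0 \<le> Poly_Mapping.lookup D p)"

definition degree_divisor :: "(complex set \<Rightarrow>\<^sub>0 int) \<Rightarrow> int" where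
  "degree_divisor D = (\<Sum>p\<in>Poly_Mapping.keys D. Poly_Mapping.lookup D p)"

text \<open>\<^term>\<open>D\<close> is the divisor of zeros and poles of \<^term>\<open>f\<close>; only functions that are not
  identically zero have one. Removable singularities do not affect \<^const>\<open>zorder\<close>.\<close>

definition has_divisor :: "complex set \<Rightarrow> (complex \<Rightarrow> complex) \<Rightarrow> (complex set \<Rightarrow>\<^sub>0 int) \<Rightarrow> bool" where
  "has_divisor \<Lambda> f D \<longleftrightarrow>
     divisor_on \<Lambda> D \<and> f meromorphic_on UNIV \<and>
     (\<forall>z. (\<exists>\<^sub>F w in at z. f w \<noteq> 0) \<and> zorder f z = Poly_Mapping.lookup D (torus_point \<Lambda> z))"

text \<open>Equations between meromorphic functions are required off a discrete closed set, because the
  values that HOL functions such as quotients take at poles and at common zeros carry no meaning.\<close>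

definition elliptic_first_kind :: "complex \<Rightarrow> complex \<Rightarrow> (complex \<Rightarrow> complex) \<Rightarrow> bool" where
  "elliptic_first_kind \<omega>\<^sub>1 \<omega>\<^sub>2 f \<longleftrightarrow>
     f meromorphic_on UNIV \<and>
     (\<forall>\<omega>\<in>{\<omega>\<^sub>1, \<omega>\<^sub>2}. \<forall>\<^sub>\<approx>z. f (z + 2 * \<omega>) = f z)"

definition elliptic_second_kind :: "complex \<Rightarrow> complex \<Rightarrow> (complex \<Rightarrow> complex) \<Rightarrow> bool" where
  "elliptic_second_kind \<omega>\<^sub>1 \<omega>\<^sub>2 f \<longleftrightarrow>
     f meromorphic_on UNIV \<and>
     (\<forall>\<omega>\<in>{\<omega>\<^sub>1, \<omega>\<^sub>2}. \<exists>\<rho>. \<forall>\<^sub>\<approx>z. f (z + 2 * \<omega>) = \<rho> * f z)"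

definition elliptic_third_kind :: "complex \<Rightarrow> complex \<Rightarrow> (complex \<Rightarrow> complex) \<Rightarrow> bool" where
  "elliptic_third_kind \<omega>\<^sub>1 \<omega>\<^sub>2 f \<longleftrightarrow>
     f meromorphic_on UNIV \<and>
     (\<forall>\<omega>\<in>{\<omega>\<^sub>1, \<omega>\<^sub>2}. \<exists>a b. \<forall>\<^sub>\<approx>z. f (z + 2 * \<omega>) = exp (a * z + b) * f z)"


section \<open>Uniformly periodic linear systems\<close>

definition periodic_group :: "complex set \<Rightarrow> ('h::complex_hilbert \<Rightarrow> 'h) \<Rightarrow> bool" where
  "periodic_group \<Omega> A \<longleftrightarrow>
     (\<exists>p\<in>\<Omega>. p \<noteq> 0 \<and> (\<forall>x\<in>\<real>. exp_op (x + p) A = exp_op x A))"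

text \<open>The set \<^term>\<open>\<Omega>\<close> specifies where the period has to lie; periodicity in the real variable
  is the case \<open>\<Omega> = \<real>\<close>.

  A real period \<open>p\<close> of the group is a period of \<open>\<tau>\<close>. If \<open>\<tau>\<close> is not identically zero and its
  zeros include a coset of a lattice \<open>\<Lambda>\<close>, then these zeros include \<open>a + \<Lambda> + \<int>p\<close>, which is
  discrete only if a nonzero multiple of \<open>p\<close> lies in \<open>\<Lambda>\<close>. So, for nonzero divisors, real periods are available exactly
  for lattices that contain a nonzero real number (for instance if \<open>\<omega>\<^sub>1\<close> is real). For all other
  lattices the group can only be periodic in a nonreal direction.\<close>

definition admissible_periods :: "complex set \<Rightarrow> complex set" where
  "admissible_periods \<Lambda> = (if \<exists>r\<in>\<Lambda> \<inter> \<real>. r \<noteq> 0 then \<real> else UNIV)"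

definition uniformly_periodic_system ::
    "complex set \<Rightarrow> ('h::complex_hilbert \<Rightarrow> 'h) \<Rightarrow> ('h0::complex_hilbert \<Rightarrow> 'h) \<Rightarrow> ('h \<Rightarrow> 'h0) \<Rightarrow> ('h \<Rightarrow> 'h) \<Rightarrow> bool" where
  "uniformly_periodic_system \<Omega> A B C E \<longleftrightarrow>
     bounded_clinear A \<and> periodic_group \<Omega> A \<and>
     bounded_clinear B \<and> bounded_clinear C \<and> trace_class E \<and>
     (\<forall>x. A (E x) + E (A x) = B (C x))"

definition tau :: "('h::complex_hilbert \<Rightarrow> 'h) \<Rightarrow> ('h \<Rightarrow> 'h) \<Rightarrow> complex \<Rightarrow> complex" where
  "tau A E z = fredholm_det (exp_op z A \<circ> E \<circ> exp_op z A)"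

end

theory Submission
  imports Defs
begin

text \<open>
  The idea is to realize theta functions as determinants of diagonal operators. If \<open>A\<close> and \<open>E\<close> are
  diagonal on \<open>\<ell>\<^sup>2\<close> with entries \<open>a n\<close> (bounded) and \<open>d n\<close> (absolutely summable), then \<open>A\<close> and \<open>E\<close>
  commute, the equation \<open>AE + EA = BC\<close> is solved by \<open>B = I\<close>, and
  \<open>\<tau>(z) = \<Prod>\<^sub>n (1 + d n * exp (2 * z * a n))\<close> (\<open>exists_uniformly_periodic_system\<close>,
  \<open>fredholm_det_diag_op\<close>). The group generated by \<open>A\<close> has period \<open>p\<close> as soon as all \<open>p * a n\<close> lie
  in \<open>2 \<pi> \<i> \<int>\<close>. Functions of this form are closed under products, because one can take direct sums
  of systems (\<open>diagonal_tau_mult\<close>).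

  Let \<open>v\<close>, \<open>w\<close> be a positively oriented basis of the lattice and put \<open>e z = exp (2 \<pi> \<i> z / v)\<close>,
  \<open>q = e w\<close>. The product
  \<open>\<Prod>\<^sub>n\<^sub>\<ge>\<^sub>0 (1 - q\<^sup>n * e (z - a)) * (1 - q\<^sup>n\<^sup>+\<^sup>1 * e (a - z))\<close> is a theta function: it is entire, has simple
  zeros exactly at the lattice translates of \<open>a\<close>, has the period \<open>v\<close>, and is multiplied by
  \<open>- e (a - z)\<close> under \<open>z \<mapsto> z + w\<close> (\<open>theta_v\<close>, \<open>theta_w\<close>, \<open>zorder_theta\<close>). It has the diagonal form
  above, with entries \<open>\<plusminus> \<pi> \<i> / v\<close> for \<open>A\<close> and geometric sequences for \<open>E\<close>
  (\<open>diagonal_tau_theta\<close>), and the group then has the period \<open>2 * v\<close>. If the lattice contains nonzero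
  real numbers, the period is required to be real; \<open>exists_adapted_basis\<close> provides a basis with
  real \<open>v\<close> in this case.

  A positive divisor is the divisor of a finite product of such theta functions, which is elliptic of
  the third kind. For a divisor of degree zero, the quotient of two such products with equally many
  factors is invariant under \<open>v\<close>, and under \<open>w\<close> it is multiplied by the constant \<open>e (s - t)\<close>, where
  \<open>s\<close> and \<open>t\<close> are the sums of the zeros and of the poles (\<open>theta_quotient_w\<close>); so it is
  elliptic of the second kind. If \<open>s - t\<close> is a lattice vector, replacing one zero by an equivalent
  point achieves \<open>s = t\<close>, and the quotient becomes doubly periodic.
\<close>

section \<open>Diagonal operators on square summable sequences\<close>

lemma vector_space_scaleC: "vector_space (scaleC :: complex \<Rightarrow> 'a::complex_hilbert \<Rightarrow> 'a)"
proof
  fix x :: 'a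
  show "1 *\<^sub>C x = x"
    using scaleC_of_real[of 1 x] by simp
qed (simp_all add: scaleC_add_right scaleC_add_left scaleC_scaleC)

lemma ell2_eqI: "(\<And>n. ell2_nth x n = ell2_nth y n) \<Longrightarrow> x = y"
  by (simp add: ell2_nth_inject[symmetric] fun_eq_iff)

lemmas ell2_nth_simps =
  zero_ell2.rep_eq plus_ell2.rep_eq minus_ell2.rep_eq uminus_ell2.rep_eq
  scaleR_ell2.rep_eq scaleC_ell2.rep_eq

lemma bounded_linear_ell2_nth: "bounded_linear (\<lambda>x. ell2_nth x n)"
proof
  show "\<exists>K. \<forall>x. norm (ell2_nth x n) \<le> norm x * K"
    using cmod_ell2_nth_le[of _ n] by (intro exI[of _ 1]) simp
qed (simp_all add: ell2_nth_simps scaleR_conv_of_real)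

lift_definition ell2_unit :: "nat \<Rightarrow> ell2" is "\<lambda>k n. if n = k then 1 else 0"
proof -
  fix k :: nat
  have "summable (\<lambda>n. if n = k then 1 else (0::real))"
    using summable_finite[of "{k}" "\<lambda>n. if n = k then 1 else (0::real)"] by simp
  moreover have "(\<lambda>n. (cmod (if n = k then 1 else 0))\<^sup>2) = (\<lambda>n. if n = k then 1 else (0::real))"
    by auto
  ultimately show "summable (\<lambda>n. (cmod (if n = k then 1 else 0))\<^sup>2)"
    by simp
qed

lemma cinner_ell2_unit: "cinner (ell2_unit k) x = ell2_nth x k"
proof -
  have "(\<lambda>n. cnj (ell2_nth (ell2_unit k) n) * ell2_nth x n)
          = (\<lambda>n. if n = k then ell2_nth x k else 0)"
    by (auto simp: ell2_unit.rep_eq)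
  then show ?thesis
    using sums_single[of k "\<lambda>_. ell2_nth x k"] by (simp add: cinner_ell2.rep_eq sums_iff eq_commute)
qed

lemma inj_ell2_unit: "inj ell2_unit"
proof (rule injI)
  fix j k assume "ell2_unit j = ell2_unit k"
  then have "ell2_nth (ell2_unit j) j = ell2_nth (ell2_unit k) j"
    by simp
  then show "j = k"
    by (simp add: ell2_unit.rep_eq split: if_splits)
qed

lemma orthonormal_basis_ell2_unit: "orthonormal_basis (range ell2_unit)"
  unfolding orthonormal_basis_def
proof (intro conjI ballI allI impI)
  fix e f assume "e \<in> range ell2_unit" "f \<in> range ell2_unit"
  then show "cinner e f = (if e = f then 1 else 0)"
    using inj_ell2_unit by (auto simp: cinner_ell2_unit ell2_unit.rep_eq inj_eq)
next
  fix x assume "\<forall>e\<in>range ell2_unit. cinner e x = 0"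
  then show "x = 0"
    by (intro ell2_eqI) (auto simp: cinner_ell2_unit ell2_nth_simps)
qed

definition diag_op :: "(nat \<Rightarrow> complex) \<Rightarrow> ell2 \<Rightarrow> ell2" where
  "diag_op d x = Abs_ell2 (\<lambda>n. d n * ell2_nth x n)"

lemma ell2_nth_diag_op:
  assumes "bounded (range d)"
  shows "ell2_nth (diag_op d x) n = d n * ell2_nth x n"
proof -
  obtain K where K: "\<And>n. norm (d n) \<le> K"
    using assms by (auto simp: bounded_iff)
  have "summable (\<lambda>n. (cmod (d n * ell2_nth x n))\<^sup>2)"
  proof (rule summable_comparison_test')
    show "summable (\<lambda>n. K\<^sup>2 * (cmod (ell2_nth x n))\<^sup>2)"
      by (intro summable_mult ell2_summable)
    show "norm ((cmod (d n * ell2_nth x n))\<^sup>2) \<le> K\<^sup>2 * (cmod (ell2_nth x n))\<^sup>2" for n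
      using K[of n] by (auto simp: norm_mult power_mult_distrib intro!: mult_right_mono power_mono)
  qed
  then show ?thesis
    by (simp add: diag_op_def Abs_ell2_inverse)
qed

lemma norm_diag_op_le:
  assumes "\<And>n. norm (d n) \<le> K"
  shows "norm (diag_op d x) \<le> K * norm x"
proof (rule norm_ell2_leI)
  fix N
  have bd: "bounded (range d)"
    using assms by (auto simp: bounded_iff)
  have K: "0 \<le> K"
    using assms[of 0] norm_ge_zero order_trans by blast
  have "L2_set (\<lambda>n. cmod (ell2_nth (diag_op d x) n)) {..<N}
          \<le> L2_set (\<lambda>n. K * cmod (ell2_nth x n)) {..<N}"
    using assms by (intro L2_set_mono) (auto simp: ell2_nth_diag_op[OF bd] norm_mult intro!: mult_right_mono)
  also have "\<dots> = K * L2_set (\<lambda>n. cmod (ell2_nth x n)) {..<N}"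
    using K by (simp add: L2_set_right_distrib)
  also have "\<dots> \<le> K * norm x"
    using K by (intro mult_left_mono L2_set_le_norm_ell2) auto
  finally show "L2_set (\<lambda>n. cmod (ell2_nth (diag_op d x) n)) {..<N} \<le> K * norm x" .
qed

lemma bounded_clinear_diag_op:
  assumes "bounded (range d)"
  shows "bounded_clinear (diag_op d)"
proof -
  obtain K where K: "\<And>n. norm (d n) \<le> K"
    using assms by (auto simp: bounded_iff)
  note nth = ell2_nth_diag_op[OF assms] ell2_nth_simps
  have "bounded_linear (diag_op d)"
  proof
    show "\<exists>K. \<forall>x. norm (diag_op d x) \<le> norm x * K"
      using norm_diag_op_le[of d K] K by (intro exI[of _ K]) (simp add: mult.commute)
  qed (auto intro!: ell2_eqI simp: nth algebra_simps)
  moreover have "diag_op d (c *\<^sub>C x) = c *\<^sub>C diag_op d x" for c x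
    by (auto intro!: ell2_eqI simp: nth)
  ultimately show ?thesis
    by (simp add: bounded_clinear_def)
qed

lemma diag_op_diag_op:
  assumes "bounded (range a)" "bounded (range b)"
  shows "diag_op a (diag_op b x) = diag_op (\<lambda>n. a n * b n) x"
  by (simp add: diag_op_def[of a] diag_op_def[of "\<lambda>n. a n * b n"] ell2_nth_diag_op[OF assms(2)] mult.assoc)

lemma bounded_range_if_abs_summable:
  fixes d :: "nat \<Rightarrow> 'a::real_normed_vector"
  assumes "summable (\<lambda>n. norm (d n))"
  shows "bounded (range d)"
proof -
  have "d \<longlonglongrightarrow> 0"
    using summable_LIMSEQ_zero[OF assms] by (simp add: tendsto_norm_zero_iff)
  then have "Bseq d"
    by (intro convergent_imp_Bseq convergentI)
  then show ?thesis
    by (simp add: Bseq_eq_bounded)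
qed

text \<open>The modulus of a diagonal operator is the diagonal operator of the absolute values, whose
  trace over the unit vectors is the \<open>\<ell>\<^sup>1\<close> norm of the diagonal.\<close>

lemma trace_class_diag_op:
  assumes "summable (\<lambda>n. norm (d n))"
  shows "trace_class (diag_op d)"
proof -
  define m where "m n = complex_of_real (norm (d n))" for n
  have d: "bounded (range d)" and m: "bounded (range m)"
    using assms by (auto intro!: bounded_range_if_abs_summable simp: m_def)
  have sums: "summable (\<lambda>n. cnj (ell2_nth f n) * ell2_nth g n)" for f g
    by (intro ell2_mult_summable ell2_summable)
  have "is_modulus (diag_op m) (diag_op d)"
    unfolding is_modulus_def
  proof (intro conjI allI)
    show "bounded_clinear (diag_op m)"
      by (rule bounded_clinear_diag_op[OF m])
    fix x y :: ell2
    have *: "cnj (ell2_nth x n) * ell2_nth (diag_op m x) n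
               = complex_of_real (norm (d n) * (norm (ell2_nth x n))\<^sup>2)" for n
      using complex_norm_square[of "ell2_nth x n"]
      by (simp add: ell2_nth_diag_op[OF m] m_def mult.left_commute mult.commute)
    have s: "summable (\<lambda>n. norm (d n) * (norm (ell2_nth x n))\<^sup>2)"
      using sums[of x "diag_op m x"] unfolding * by (simp only: summable_of_real_iff)
    have "cinner x (diag_op m x) = of_real (suminf (\<lambda>n. norm (d n) * (norm (ell2_nth x n))\<^sup>2))"
      unfolding cinner_ell2.rep_eq * by (rule suminf_of_real[OF s, symmetric])
    then show "cinner x (diag_op m x) \<in> \<real>\<^sub>\<ge>\<^sub>0"
      using s by (auto intro!: suminf_nonneg simp: nonneg_Reals_of_real_iff)
    have "cnj (m n) * m n = cnj (d n) * d n" for n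
      using complex_norm_square[of "d n"] by (simp add: m_def power2_eq_square mult.commute)
    then have "cnj (m n * ell2_nth x n) * (m n * ell2_nth y n)
             = cnj (d n * ell2_nth x n) * (d n * ell2_nth y n)" for n
      by (simp add: mult_ac) 
    then show "cinner (diag_op m x) (diag_op m y) = cinner (diag_op d x) (diag_op d y)"
      by (simp only: cinner_ell2.rep_eq ell2_nth_diag_op[OF m] ell2_nth_diag_op[OF d])
  qed
  moreover have "(\<lambda>e. Re (cinner e (diag_op m e))) summable_on (range ell2_unit)"
  proof -
    have "(\<lambda>n. norm (d n)) summable_on UNIV"
      using assms by (intro norm_summable_imp_summable_on) simp
    moreover have "((\<lambda>e. Re (cinner e (diag_op m e))) \<circ> ell2_unit) = (\<lambda>n. norm (d n))"
      by (auto simp: cinner_ell2_unit ell2_nth_diag_op[OF m] ell2_unit.rep_eq m_def)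
    ultimately show ?thesis
      by (subst summable_on_reindex[OF inj_ell2_unit]) simp
  qed
  ultimately show ?thesis
    unfolding trace_class_def
    using bounded_clinear_diag_op[OF d] orthonormal_basis_ell2_unit by blast
qed

lemma diag_op_funpow:
  assumes "bounded (range a)"
  shows "ell2_nth ((diag_op a ^^ k) x) n = a n ^ k * ell2_nth x n"
  by (induction k) (simp_all add: ell2_nth_diag_op[OF assms] mult_ac)

lemma bounded_exp_range:
  fixes a :: "nat \<Rightarrow> complex"
  assumes "bounded (range a)"
  obtains K where "\<And>n. norm (exp (z * a n)) \<le> K"
proof -
  obtain M where M: "\<And>n. norm (a n) \<le> M"
    using assms by (auto simp: bounded_iff)
  have "norm (exp (z * a n)) \<le> exp (norm z * M)" for n
    using norm_exp[of "z * a n"] M[of n]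
    by (smt (verit) exp_le_cancel_iff mult_left_mono norm_ge_zero norm_mult)
  then show ?thesis using that by blast
qed

text \<open>The series converges in norm by comparison with the exponential series, so evaluation at a
  coordinate may be exchanged with it, and the coordinates are scalar exponential series.\<close>

lemma exp_op_diag_op:
  assumes a: "bounded (range a)"
  shows "exp_op z (diag_op a) = diag_op (\<lambda>n. exp (z * a n))"
proof
  fix x
  obtain K where K: "\<And>n. norm (a n) \<le> K"
    using a by (auto simp: bounded_iff)
  have K0: "0 \<le> K"
    using K[of 0] norm_ge_zero order_trans by blast
  have bd: "bounded (range (\<lambda>n. exp (z * a n)))"
    using bounded_exp_range[OF a, of z] by (metis (no_types, lifting) bounded_iff rangeE)
  have pow: "norm ((diag_op a ^^ k) x) \<le> K ^ k * norm x" for k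
  proof (induction k)
    case (Suc k)
    have "norm ((diag_op a ^^ Suc k) x) \<le> K * norm ((diag_op a ^^ k) x)"
      using norm_diag_op_le[of a K] K by simp
    also have "\<dots> \<le> K * (K ^ k * norm x)"
      by (intro mult_left_mono Suc.IH K0)
    finally show ?case by (simp add: mult_ac)
  qed simp
  have normC: "norm (c *\<^sub>C y) \<le> norm c * norm y" for c and y :: ell2
    by (rule norm_ell2_leI)
       (use L2_set_le_norm_ell2 in \<open>auto simp: ell2_nth_simps norm_mult L2_set_right_distrib[symmetric]
          intro!: mult_left_mono\<close>)
  have "summable (\<lambda>k. (z ^ k / fact k) *\<^sub>C (diag_op a ^^ k) x)"
  proof (rule summable_comparison_test')
    show "summable (\<lambda>k. inverse (fact k) * (norm z * K) ^ k * norm x)"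
      by (intro summable_mult2 summable_exp)
    fix k
    have "norm ((z ^ k / fact k) *\<^sub>C (diag_op a ^^ k) x) \<le> norm (z ^ k / fact k) * (K ^ k * norm x)"
      by (rule order_trans[OF normC]) (intro mult_left_mono pow norm_ge_zero)
    then show "norm ((z ^ k / fact k) *\<^sub>C (diag_op a ^^ k) x)
                 \<le> inverse (fact k) * (norm z * K) ^ k * norm x"
      by (simp add: norm_divide norm_power power_mult_distrib field_simps)
  qed
  note sum = bounded_linear.suminf[OF bounded_linear_ell2_nth this]
  show "exp_op z (diag_op a) x = diag_op (\<lambda>n. exp (z * a n)) x"
  proof (rule ell2_eqI)
    fix n
    have "(\<lambda>k. ((z * a n) ^ k /\<^sub>R fact k) * ell2_nth x n) sums (exp (z * a n) * ell2_nth x n)"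
      by (intro sums_mult2 exp_converges)
    then have "(\<lambda>k. ell2_nth ((z ^ k / fact k) *\<^sub>C (diag_op a ^^ k) x) n)
                 sums (exp (z * a n) * ell2_nth x n)"
      by (simp add: ell2_nth_simps diag_op_funpow[OF a] scaleR_conv_of_real field_simps)
    then show "ell2_nth (exp_op z (diag_op a) x) n = ell2_nth (diag_op (\<lambda>n. exp (z * a n)) x) n"
      by (simp add: exp_op_def sum ell2_nth_diag_op[OF bd] sums_iff)
  qed
qed

section \<open>Unconditional convergence of infinite products\<close>

lemma convergent_prod_if_abs_summable:
  fixes d :: "nat \<Rightarrow> complex"
  assumes "summable (\<lambda>n. norm (d n))"
  shows "convergent_prod (\<lambda>n. 1 + d n)"
  by (intro abs_convergent_prod_imp_convergent_prod)
     (use assms in \<open>simp add: abs_convergent_prod_conv_summable\<close>)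

lemma prodinf_LIMSEQ_lessThan:
  fixes d :: "nat \<Rightarrow> complex"
  assumes "summable (\<lambda>n. norm (d n))"
  shows "(\<lambda>N. \<Prod>n<N. 1 + d n) \<longlonglongrightarrow> (prodinf (\<lambda>n. 1 + d n))"
  using convergent_prod_LIMSEQ[OF convergent_prod_if_abs_summable[OF assms]]
  by (simp add: LIMSEQ_lessThan_iff_atMost)

text \<open>Splitting \<open>G\<close> into \<open>{..<N}\<close> and the rest \<open>R\<close>, the difference is the initial product times
  \<open>\<Prod>\<^sub>R (1 + d) - 1\<close>, and the second factor is small since \<open>R\<close> lies in the tail. The bound does
  not depend on \<open>G\<close>, which is what makes the convergence of the product unconditional.\<close>

lemma norm_prod_union_diff_le:
  fixes d :: "nat \<Rightarrow> complex"
  assumes "summable (\<lambda>n. norm (d n))" "finite G" "{..<N} \<subseteq> G"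
  shows "norm ((\<Prod>n\<in>G. 1 + d n) - (\<Prod>n<N. 1 + d n))
           \<le> exp (suminf (\<lambda>n. norm (d n))) * (exp (suminf (\<lambda>n. norm (d (n + N)))) - 1)"
proof -
  have exp_bound: "(\<Prod>n\<in>A. 1 + norm (d n)) \<le> exp (\<Sum>n\<in>A. norm (d n))" if "finite A" for A
    using that by (simp add: exp_sum prod_mono)
  define R where "R = G - {..<N}"
  have R: "finite R" "G = {..<N} \<union> R" "{..<N} \<inter> R = {}"
    using assms by (auto simp: R_def)
  have s': "summable (\<lambda>n. norm (d (n + N)))"
    using assms(1) by (subst summable_iff_shift)
  have "(\<Sum>n\<in>R. norm (d n)) = (\<Sum>n\<in>(\<lambda>n. n - N) ` R. norm (d (n + N)))"
    by (subst sum.reindex) (auto simp: R_def inj_on_def not_less intro!: sum.cong)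
  also have "\<dots> \<le> (suminf (\<lambda>n. norm (d (n + N))))"
    by (intro sum_le_suminf s') (auto simp: R)
  finally have R_sum: "(\<Sum>n\<in>R. norm (d n)) \<le> (suminf (\<lambda>n. norm (d (n + N))))" .
  have "norm ((\<Prod>n\<in>R. 1 + d n) - 1) \<le> (\<Prod>n\<in>R. 1 + norm (d n)) - 1"
    by (rule norm_prod_minus1_le_prod_minus1)
  also have "\<dots> \<le> exp (suminf (\<lambda>n. norm (d (n + N)))) - 1"
    using exp_bound[OF R(1)] R_sum by (smt (verit) exp_le_cancel_iff)
  finally have 1: "norm ((\<Prod>n\<in>R. 1 + d n) - 1) \<le> exp (suminf (\<lambda>n. norm (d (n + N)))) - 1" .
  have "norm (\<Prod>n<N. 1 + d n) \<le> (\<Prod>n<N. 1 + norm (d n))"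
    unfolding prod_norm[symmetric] by (intro prod_mono) (auto intro: norm_triangle_le)
  also have "\<dots> \<le> exp (\<Sum>n<N. norm (d n))"
    by (rule exp_bound) simp
  also have "\<dots> \<le> exp (suminf (\<lambda>n. norm (d n)))"
    using assms(1) by (simp add: sum_le_suminf)
  finally have 2: "norm (\<Prod>n<N. 1 + d n) \<le> exp (suminf (\<lambda>n. norm (d n)))" .
  have "(\<Prod>n\<in>G. 1 + d n) - (\<Prod>n<N. 1 + d n)
          = (\<Prod>n<N. 1 + d n) * ((\<Prod>n\<in>R. 1 + d n) - 1)"
    using R by (simp add: prod.union_disjoint algebra_simps)
  then show ?thesis
    using mult_mono[OF 2 1] by (simp add: norm_mult)
qed

text \<open>The eigenvalues of an operator come without an enumeration, so the determinant is a limit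
  along a net of finite sets; this connects such limits with the sequential infinite product.\<close>

lemma prod_tendsto_prodinf_finite_sets_at_top:
  fixes d :: "nat \<Rightarrow> complex"
  assumes "summable (\<lambda>n. norm (d n))"
  shows "((\<lambda>G. \<Prod>n\<in>G. 1 + d n) \<longlongrightarrow> (prodinf (\<lambda>n. 1 + d n))) finite_sets_at_top"
proof (rule tendstoI)
  fix \<epsilon> :: real assume "\<epsilon> > 0"
  define P where "P = prodinf (\<lambda>n. 1 + d n)"
  have "(\<lambda>N. exp (suminf (\<lambda>n. norm (d n))) * (exp (suminf (\<lambda>n. norm (d (n + N)))) - 1))
          \<longlonglongrightarrow> exp (suminf (\<lambda>n. norm (d n))) * (exp 0 - 1)"
    by (intro tendsto_intros suminf_exist_split2 assms)
  then have "\<forall>\<^sub>F N in sequentially. exp (suminf (\<lambda>n. norm (d n))) * (exp (suminf (\<lambda>n. norm (d (n + N)))) - 1) < \<epsilon> / 2"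
    by (rule order_tendstoD(2)) (use \<open>\<epsilon> > 0\<close> in simp)
  moreover have "\<forall>\<^sub>F N in sequentially. dist (\<Prod>n<N. 1 + d n) P < \<epsilon> / 2"
    using tendstoD[OF prodinf_LIMSEQ_lessThan[OF assms], of "\<epsilon> / 2"] \<open>\<epsilon> > 0\<close> by (simp add: P_def)
  ultimately have "\<forall>\<^sub>F N in sequentially.
      exp (suminf (\<lambda>n. norm (d n))) * (exp (suminf (\<lambda>n. norm (d (n + N)))) - 1) < \<epsilon> / 2
      \<and> dist (\<Prod>n<N. 1 + d n) P < \<epsilon> / 2"
    by (rule eventually_conj)
  then obtain N where N:
      "exp (suminf (\<lambda>n. norm (d n))) * (exp (suminf (\<lambda>n. norm (d (n + N)))) - 1) < \<epsilon> / 2"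
      "dist (\<Prod>n<N. 1 + d n) P < \<epsilon> / 2"
    by (auto simp: eventually_sequentially)
  show "\<forall>\<^sub>F G in finite_sets_at_top. dist (\<Prod>n\<in>G. 1 + d n) (prodinf (\<lambda>n. 1 + d n)) < \<epsilon>"
    unfolding eventually_finite_subsets_at_top
  proof (intro exI[of _ "{..<N}"] conjI allI impI; (elim conjE)?)
    fix G assume G: "finite G" "{..<N} \<subseteq> G"
    have "dist (\<Prod>n\<in>G. 1 + d n) (\<Prod>n<N. 1 + d n) < \<epsilon> / 2"
      using norm_prod_union_diff_le[OF assms G] N(1) by (simp add: dist_norm)
    with N(2) show "dist (\<Prod>n\<in>G. 1 + d n) (prodinf (\<lambda>n. 1 + d n)) < \<epsilon>"
      using dist_triangle[of "\<Prod>n\<in>G. 1 + d n" P "\<Prod>n<N. 1 + d n"] unfolding P_def by linarith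
  qed auto
qed

section \<open>Determinants of diagonal operators\<close>

lemma eigenvalue_diag_op_iff:
  assumes d: "bounded (range d)"
  shows "eigenvalue (diag_op d) \<mu> \<longleftrightarrow> \<mu> \<in> range d"
proof
  assume "eigenvalue (diag_op d) \<mu>"
  then obtain x where x: "x \<noteq> 0" "diag_op d x = \<mu> *\<^sub>C x"
    by (auto simp: eigenvalue_def)
  obtain n where n: "ell2_nth x n \<noteq> 0"
    using x(1) by (metis ell2_eqI zero_ell2.rep_eq)
  have "d n * ell2_nth x n = \<mu> * ell2_nth x n"
    using arg_cong[OF x(2), of "\<lambda>y. ell2_nth y n"] by (simp add: ell2_nth_diag_op[OF d] ell2_nth_simps)
  then show "\<mu> \<in> range d"
    using n by auto
next
  assume "\<mu> \<in> range d"
  then obtain k where k: "\<mu> = d k" by auto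
  have "ell2_unit k \<noteq> 0"
  proof
    assume "ell2_unit k = 0"
    then have "ell2_nth (ell2_unit k) k = ell2_nth 0 k" by simp
    then show False by (simp add: ell2_unit.rep_eq ell2_nth_simps)
  qed
  moreover have "diag_op d (ell2_unit k) = \<mu> *\<^sub>C ell2_unit k"
    by (rule ell2_eqI) (simp add: ell2_nth_diag_op[OF d] ell2_nth_simps ell2_unit.rep_eq k)
  ultimately show "eigenvalue (diag_op d) \<mu>"
    by (auto simp: eigenvalue_def)
qed

text \<open>All positive powers of \<open>diag_op d - \<mu>\<close> have the same kernel, namely the sequences supported on the
  indices \<open>n\<close> with \<open>d n = \<mu>\<close>; the unit vectors at these indices are a basis of it.\<close>

lemma alg_mult_diag_op:
  assumes d: "bounded (range d)" and fin: "finite (d -` {\<mu>})"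
  shows "alg_mult (diag_op d) \<mu> = card (d -` {\<mu>})"
proof -
  interpret vector_space "scaleC :: complex \<Rightarrow> ell2 \<Rightarrow> ell2"
    by (rule vector_space_scaleC)
  define M where "M = d -` {\<mu>}"
  define V where "V = {x. \<exists>k. ((\<lambda>y. diag_op d y - \<mu> *\<^sub>C y) ^^ k) x = 0}"
  have pow: "ell2_nth (((\<lambda>y. diag_op d y - \<mu> *\<^sub>C y) ^^ k) x) n = (d n - \<mu>) ^ k * ell2_nth x n" for k x n
    by (induction k) (simp_all add: ell2_nth_diag_op[OF d] ell2_nth_simps algebra_simps)
  have V: "x \<in> V \<longleftrightarrow> (\<forall>n. n \<notin> M \<longrightarrow> ell2_nth x n = 0)" for x
  proof
    assume "x \<in> V"
    then obtain k where k: "((\<lambda>y. diag_op d y - \<mu> *\<^sub>C y) ^^ k) x = 0"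
      by (auto simp: V_def)
    have "(d n - \<mu>) ^ k * ell2_nth x n = 0" for n
      using pow[of k x n] by (simp add: k ell2_nth_simps)
    then show "\<forall>n. n \<notin> M \<longrightarrow> ell2_nth x n = 0"
      by (auto simp: M_def)
  next
    assume *: "\<forall>n. n \<notin> M \<longrightarrow> ell2_nth x n = 0"
    have "((\<lambda>y. diag_op d y - \<mu> *\<^sub>C y) ^^ 1) x = 0"
      by (rule ell2_eqI, subst pow) (use * in \<open>auto simp: ell2_nth_simps M_def\<close>)
    then show "x \<in> V"
      unfolding V_def by blast
  qed
  have nth_sum: "ell2_nth (\<Sum>k\<in>A. f k) n = (\<Sum>k\<in>A. ell2_nth (f k) n)" for A n and f :: "'b \<Rightarrow> ell2"
    by (induction A rule: infinite_finite_induct) (simp_all add: ell2_nth_simps)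
  have "dim V = card (ell2_unit ` M)"
  proof (rule dim_unique)
    show "ell2_unit ` M \<subseteq> V"
      by (auto simp: V ell2_unit.rep_eq)
    show "V \<subseteq> span (ell2_unit ` M)"
    proof
      fix x assume "x \<in> V"
      have "x = (\<Sum>k\<in>M. ell2_nth x k *\<^sub>C ell2_unit k)"
      proof (rule ell2_eqI)
        fix n
        have "ell2_nth (\<Sum>k\<in>M. ell2_nth x k *\<^sub>C ell2_unit k) n = (\<Sum>k\<in>M. if n = k then ell2_nth x k else 0)"
          by (auto simp: nth_sum ell2_nth_simps ell2_unit.rep_eq intro!: sum.cong)
        also have "\<dots> = ell2_nth x n"
          using \<open>x \<in> V\<close> fin by (auto simp: V M_def)
        finally show "ell2_nth x n = ell2_nth (\<Sum>k\<in>M. ell2_nth x k *\<^sub>C ell2_unit k) n" ..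
      qed
      also have "\<dots> \<in> span (ell2_unit ` M)"
        by (intro span_sum span_scale span_base) auto
      finally show "x \<in> span (ell2_unit ` M)" .
    qed
    show "independent (ell2_unit ` M)"
    proof (rule independent_if_scalars_zero)
      fix f x assume 0: "(\<Sum>y\<in>ell2_unit ` M. f y *\<^sub>C y) = 0" and "x \<in> ell2_unit ` M"
      then obtain k where k: "k \<in> M" "x = ell2_unit k" by auto
      have "0 = (\<Sum>j\<in>M. f (ell2_unit j) *\<^sub>C ell2_unit j)"
        using 0 by (subst (asm) sum.reindex) (auto intro: inj_on_subset[OF inj_ell2_unit])
      from arg_cong[OF this, of "\<lambda>y. ell2_nth y k"]
      have "0 = (\<Sum>j\<in>M. if k = j then f (ell2_unit j) else 0)"
        by (simp add: nth_sum ell2_nth_simps ell2_unit.rep_eq if_distrib cong: if_cong)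
      then show "f x = 0"
        using k fin by (simp add: M_def)
    qed (use fin in \<open>simp add: M_def\<close>)
  qed simp
  then show ?thesis
    by (simp add: alg_mult_def V_def M_def card_image inj_on_subset[OF inj_ell2_unit])
qed

text \<open>A finite set \<open>F\<close> of nonzero eigenvalues corresponds to the finite set \<open>d -` F\<close> of indices,
  and grouping the factors over these indices by their value produces the algebraic multiplicities.
  As \<open>F\<close> grows, \<open>d -` F\<close> exhausts all indices with \<open>d n \<noteq> 0\<close>; the others contribute factors 1.\<close>

lemma fredholm_det_diag_op:
  assumes s: "summable (\<lambda>n. norm (d n))"
  shows "fredholm_det (diag_op d) = prodinf (\<lambda>n. 1 + d n)"
proof -
  have d: "bounded (range d)"
    by (rule bounded_range_if_abs_summable[OF s])
  have fin: "finite (d -` {\<mu>})" if "\<mu> \<noteq> 0" for \<mu>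
  proof -
    have "\<forall>\<^sub>F n in sequentially. norm (d n) < norm \<mu>"
      using summable_LIMSEQ_zero[OF s] that by (intro order_tendstoD(2)[of _ 0]) auto
    then obtain N where "\<forall>n\<ge>N. norm (d n) < norm \<mu>"
      by (auto simp: eventually_sequentially)
    then have "d -` {\<mu>} \<subseteq> {..<N}"
      by (auto simp: not_less[symmetric])
    then show ?thesis
      using finite_subset by blast
  qed
  define S where "S = {\<mu>. \<mu> \<noteq> 0 \<and> eigenvalue (diag_op d) \<mu>}"
  have S: "S = range d - {0}"
    by (auto simp: S_def eigenvalue_diag_op_iff[OF d])
  define R where "R F = d -` F" for F
  have R_fin: "finite (R F)" if "finite F" "F \<subseteq> S" for F
  proof -
    have "R F = (\<Union>\<mu>\<in>F. d -` {\<mu>})"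
      by (auto simp: R_def)
    then show ?thesis
      using that fin by (auto simp: S)
  qed
  have prod_eq: "(\<Prod>\<mu>\<in>F. (1 + \<mu>) ^ alg_mult (diag_op d) \<mu>) = (\<Prod>n\<in>R F. 1 + d n)"
    if "finite F" "F \<subseteq> S" for F
  proof -
    have "(\<Prod>n\<in>R F. 1 + d n) = (\<Prod>\<mu>\<in>F. \<Prod>n\<in>{n\<in>R F. d n = \<mu>}. 1 + d n)"
      using that R_fin[OF that] by (intro prod.group[symmetric]) (auto simp: R_def)
    also have "\<dots> = (\<Prod>\<mu>\<in>F. (1 + \<mu>) ^ alg_mult (diag_op d) \<mu>)"
    proof (rule prod.cong[OF refl])
      fix \<mu> assume "\<mu> \<in> F"
      then have "{n\<in>R F. d n = \<mu>} = d -` {\<mu>}" "\<mu> \<noteq> 0"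
        using that by (auto simp: R_def S)
      then show "(\<Prod>n\<in>{n\<in>R F. d n = \<mu>}. 1 + d n) = (1 + \<mu>) ^ alg_mult (diag_op d) \<mu>"
        using fin by (simp add: alg_mult_diag_op[OF d])
    qed
    finally show ?thesis ..
  qed
  have "((\<lambda>F. \<Prod>\<mu>\<in>F. (1 + \<mu>) ^ alg_mult (diag_op d) \<mu>) \<longlongrightarrow> (prodinf (\<lambda>n. 1 + d n))) (finite_subsets_at_top S)"
  proof (rule tendstoI)
    fix \<epsilon> :: real assume "\<epsilon> > 0"
    from tendstoD[OF prod_tendsto_prodinf_finite_sets_at_top[OF s] this]
    obtain X where X: "finite X"
        "\<And>G. finite G \<Longrightarrow> X \<subseteq> G \<Longrightarrow> dist (\<Prod>n\<in>G. 1 + d n) (prodinf (\<lambda>n. 1 + d n)) < \<epsilon>"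
      by (auto simp: eventually_finite_subsets_at_top)
    show "\<forall>\<^sub>F F in finite_subsets_at_top S.
            dist (\<Prod>\<mu>\<in>F. (1 + \<mu>) ^ alg_mult (diag_op d) \<mu>) (prodinf (\<lambda>n. 1 + d n)) < \<epsilon>"
      unfolding eventually_finite_subsets_at_top
    proof (intro exI[of _ "d ` X - {0}"] conjI allI impI; (elim conjE)?)
      fix F assume F: "finite F" "d ` X - {0} \<subseteq> F" "F \<subseteq> S"
      \<comment> \<open>Only indices with \<open>d n = 0\<close> can belong to \<open>X\<close> and not to \<open>R F\<close>.\<close>
      have "(\<Prod>n\<in>R F. 1 + d n) = (\<Prod>n\<in>R F \<union> X. 1 + d n)"
        using F X(1) R_fin[OF F(1,3)] by (intro prod.mono_neutral_left) (auto simp: R_def)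
      then show "dist (\<Prod>\<mu>\<in>F. (1 + \<mu>) ^ alg_mult (diag_op d) \<mu>) (prodinf (\<lambda>n. 1 + d n)) < \<epsilon>"
        using X R_fin[OF F(1,3)] by (simp add: prod_eq[OF F(1,3)])
    qed (use X in \<open>auto simp: S\<close>)
  qed
  then show ?thesis
    unfolding fredholm_det_def S_def[symmetric] by (intro tendsto_Lim) auto
qed

section \<open>Tau functions of diagonal systems\<close>

text \<open>These are the tau functions of the systems in which \<open>A\<close> and \<open>E\<close> are diagonal with entries
  \<open>a n\<close> and \<open>d n\<close>. The condition on \<open>p\<close> says that \<open>p\<close> is a period of the group generated by \<open>A\<close>.\<close>

definition diagonal_tau :: "complex \<Rightarrow> (complex \<Rightarrow> complex) \<Rightarrow> bool" where
  "diagonal_tau p f \<longleftrightarrow>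
     (\<exists>a d. bounded (range a) \<and> (\<forall>n. exp (p * a n) = 1) \<and> summable (\<lambda>n. norm (d n)) \<and>
        f = (\<lambda>z. prodinf (\<lambda>n. 1 + d n * exp (2 * z * a n))))"

lemma abs_summable_bounded_mult:
  fixes d b :: "nat \<Rightarrow> complex"
  assumes "summable (\<lambda>n. norm (d n))" "\<And>n. norm (b n) \<le> K"
  shows "summable (\<lambda>n. norm (d n * b n))"
proof (rule summable_comparison_test')
  show "summable (\<lambda>n. norm (d n) * K)"
    by (intro summable_mult2 assms)
  show "norm (norm (d n * b n)) \<le> norm (d n) * K" for n
    using assms(2) by (auto simp: norm_mult intro!: mult_left_mono)
qed

text \<open>For diagonal \<open>A\<close> and \<open>E\<close> the operator \<open>AE + EA\<close> is bounded, so the factorization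
  \<open>AE + EA = BC\<close> holds with \<open>B = I\<close>. All operators commute, hence
  \<open>e\<^sup>z\<^sup>A E e\<^sup>z\<^sup>A\<close> is diagonal with entries \<open>d n * exp (2 * z * a n)\<close>.\<close>

lemma exists_uniformly_periodic_system:
  assumes f: "diagonal_tau p f" and p: "p \<in> \<Omega>" "p \<noteq> 0"
  shows "\<exists>(A :: ell2 \<Rightarrow> ell2) (B :: ell2 \<Rightarrow> ell2) (C :: ell2 \<Rightarrow> ell2) (E :: ell2 \<Rightarrow> ell2).
           uniformly_periodic_system \<Omega> A B C E \<and> tau A E = f"
proof -
  obtain a d where a: "bounded (range a)" "\<And>n. exp (p * a n) = 1"
    and d: "summable (\<lambda>n. norm (d n))"
    and f_eq: "f = (\<lambda>z. prodinf (\<lambda>n. 1 + d n * exp (2 * z * a n)))"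
    using f unfolding diagonal_tau_def by blast
  have bd: "bounded (range d)"
    by (rule bounded_range_if_abs_summable[OF d])
  define c where "c n = 2 * a n * d n" for n
  have c: "bounded (range c)"
  proof -
    obtain K L where "\<And>n. norm (a n) \<le> K" "\<And>n. norm (d n) \<le> L"
      using a(1) bd by (auto simp: bounded_iff)
    then have "norm (c n) \<le> 2 * (K * L)" for n
      by (auto simp: c_def norm_mult intro!: mult_mono intro: order_trans[OF norm_ge_zero])
    then show ?thesis
      by (auto simp: bounded_iff)
  qed
  have "uniformly_periodic_system \<Omega> (diag_op a) id (diag_op c) (diag_op d)"
    unfolding uniformly_periodic_system_def
  proof (intro conjI allI)
    show "periodic_group \<Omega> (diag_op a)"
      unfolding periodic_group_def exp_op_diag_op[OF a(1)]
      using p a(2) by (auto simp: distrib_right exp_add)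
    show "bounded_clinear (id :: ell2 \<Rightarrow> ell2)"
      using bounded_linear_ident by (simp add: bounded_clinear_def id_def)
    show "diag_op a (diag_op d x) + diag_op d (diag_op a x) = id (diag_op c x)" for x
      by (rule ell2_eqI)
         (simp add: ell2_nth_diag_op[OF a(1)] ell2_nth_diag_op[OF bd] ell2_nth_diag_op[OF c]
            ell2_nth_simps, simp add: c_def)
  qed (intro bounded_clinear_diag_op trace_class_diag_op a c d)+
  moreover have "tau (diag_op a) (diag_op d) z = f z" for z
  proof -
    obtain K where K: "\<And>n. norm (exp (z * a n)) \<le> K"
      using bounded_exp_range[OF a(1)] by blast
    then have be: "bounded (range (\<lambda>n. exp (z * a n)))"
      by (auto simp: bounded_iff)
    have s: "summable (\<lambda>n. norm (d n * exp (z * a n)))"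
      by (rule abs_summable_bounded_mult[OF d K])
    have eq: "exp (z * a n) * (d n * exp (z * a n)) = d n * exp (2 * z * a n)" for n
      by (simp add: exp_double mult_ac power2_eq_square flip: exp_add)
    obtain K' where K': "\<And>n. norm (exp (2 * z * a n)) \<le> K'"
      using bounded_exp_range[OF a(1)] by blast
    have "diag_op (\<lambda>n. exp (z * a n)) \<circ> diag_op d \<circ> diag_op (\<lambda>n. exp (z * a n))
            = diag_op (\<lambda>n. d n * exp (2 * z * a n))"
      by (auto simp: fun_eq_iff diag_op_diag_op[OF bd be] eq
            diag_op_diag_op[OF be bounded_range_if_abs_summable[OF s]])
    then show ?thesis
      using fredholm_det_diag_op[OF abs_summable_bounded_mult[OF d K']]
      by (simp add: tau_def exp_op_diag_op[OF a(1)] f_eq)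
  qed
  ultimately show ?thesis
    by blast
qed

text \<open>The second branch reads \<open>(n - 1) div 2\<close>, in agreement with \<open>sums_if\<close>, although \<open>n div 2\<close> is the
  same number for odd \<open>n\<close>.\<close>

definition interleave :: "(nat \<Rightarrow> 'a) \<Rightarrow> (nat \<Rightarrow> 'a) \<Rightarrow> nat \<Rightarrow> 'a" where
  "interleave f g n = (if even n then f (n div 2) else g ((n - 1) div 2))"

lemma interleave_map2: "h (interleave f f' n) (interleave g g' n)
    = interleave (\<lambda>n. h (f n) (g n)) (\<lambda>n. h (f' n) (g' n)) n"
  by (simp add: interleave_def)

lemma summable_interleave:
  fixes f g :: "nat \<Rightarrow> real"
  assumes "summable f" "summable g"
  shows "summable (interleave f g)"
  using sums_if[OF summable_sums[OF assms(2)] summable_sums[OF assms(1)]]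
  by (simp add: interleave_def[abs_def] sums_iff)

lemma prodinf_interleave:
  fixes f g :: "nat \<Rightarrow> complex"
  assumes f: "summable (\<lambda>n. norm (f n))" and g: "summable (\<lambda>n. norm (g n))"
  shows "prodinf (\<lambda>n. 1 + interleave f g n) = prodinf (\<lambda>n. 1 + f n) * prodinf (\<lambda>n. 1 + g n)"
proof -
  have "(\<lambda>n. norm (interleave f g n)) = interleave (\<lambda>n. norm (f n)) (\<lambda>n. norm (g n))"
    by (auto simp: interleave_def)
  then have s: "summable (\<lambda>n. norm (interleave f g n))"
    using summable_interleave[OF f g] by simp
  have "(\<Prod>n<2 * N. 1 + interleave f g n) = (\<Prod>n<N. 1 + f n) * (\<Prod>n<N. 1 + g n)" for N
    by (induction N) (simp_all add: interleave_def mult_ac)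
  moreover have "(\<lambda>N. \<Prod>n<2 * N. 1 + interleave f g n) \<longlonglongrightarrow> prodinf (\<lambda>n. 1 + interleave f g n)"
    by (rule filterlim_compose[OF prodinf_LIMSEQ_lessThan[OF s]])
       (simp add: filterlim_subseq strict_mono_def)
  moreover have "(\<lambda>N. (\<Prod>n<N. 1 + f n) * (\<Prod>n<N. 1 + g n))
      \<longlonglongrightarrow> prodinf (\<lambda>n. 1 + f n) * prodinf (\<lambda>n. 1 + g n)"
    by (intro tendsto_mult prodinf_LIMSEQ_lessThan f g)
  ultimately show ?thesis
    using LIMSEQ_unique by auto
qed

text \<open>The direct sum of two diagonal systems acts on \<open>\<ell>\<^sup>2 \<oplus> \<ell>\<^sup>2\<close>, which is identified with \<open>\<ell>\<^sup>2\<close> by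
  interleaving coordinates; determinants of direct sums multiply.\<close>

lemma diagonal_tau_mult:
  assumes "diagonal_tau p f" "diagonal_tau p g"
  shows "diagonal_tau p (\<lambda>z. f z * g z)"
proof -
  obtain a d where a: "bounded (range a)" "\<And>n. exp (p * a n) = 1"
    and d: "summable (\<lambda>n. norm (d n))"
    and f: "f = (\<lambda>z. prodinf (\<lambda>n. 1 + d n * exp (2 * z * a n)))"
    using assms(1) unfolding diagonal_tau_def by blast
  obtain b c where b: "bounded (range b)" "\<And>n. exp (p * b n) = 1"
    and c: "summable (\<lambda>n. norm (c n))"
    and g: "g = (\<lambda>z. prodinf (\<lambda>n. 1 + c n * exp (2 * z * b n)))"
    using assms(2) unfolding diagonal_tau_def by blast
  have "range (interleave a b) \<subseteq> range a \<union> range b"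
    by (auto simp: interleave_def)
  then have "bounded (range (interleave a b))"
    using a(1) b(1) bounded_Un bounded_subset by blast
  moreover have "exp (p * interleave a b n) = 1" for n
    using a(2) b(2) by (simp add: interleave_def)
  moreover have "summable (\<lambda>n. norm (interleave d c n))"
  proof -
    have "(\<lambda>n. norm (interleave d c n)) = interleave (\<lambda>n. norm (d n)) (\<lambda>n. norm (c n))"
      by (auto simp: interleave_def)
    then show ?thesis
      using summable_interleave[OF d c] by simp
  qed
  moreover have "f z * g z = prodinf (\<lambda>n. 1 + interleave d c n * exp (2 * z * interleave a b n))" for z
  proof -
    obtain K K' where K: "\<And>n. norm (exp (2 * z * a n)) \<le> K" "\<And>n. norm (exp (2 * z * b n)) \<le> K'"
      using bounded_exp_range[OF a(1)] bounded_exp_range[OF b(1)] by metis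
    show ?thesis
      using prodinf_interleave[OF abs_summable_bounded_mult[OF d K(1)] abs_summable_bounded_mult[OF c K(2)]]
      by (simp add: f g interleave_map2[of "\<lambda>x y. x * exp (2 * z * y)"])
  qed
  ultimately show ?thesis
    unfolding diagonal_tau_def by blast
qed

lemma diagonal_tau_one: "diagonal_tau p (\<lambda>_. 1)"
  unfolding diagonal_tau_def by (intro exI[of _ "\<lambda>_. 0"]) auto

section \<open>The q-Pochhammer symbol\<close>

text \<open>This is the \<open>q\<close>-Pochhammer symbol \<open>(t; q)\<^sub>\<infinity>\<close>.\<close>

definition qprod :: "complex \<Rightarrow> complex \<Rightarrow> complex" where
  "qprod q t = prodinf (\<lambda>n. 1 - q ^ n * t)"

context
  fixes q :: complex
  assumes q: "norm q < 1"
begin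

lemma summable_qprod: "summable (\<lambda>n. norm (- (q ^ n * t)))"
  using q by (simp add: norm_mult norm_power summable_mult2 summable_geometric)

lemma convergent_qprod: "convergent_prod (\<lambda>n. 1 - q ^ n * t)"
  using convergent_prod_if_abs_summable[OF summable_qprod[of t]] by simp

lemma qprod_shift: "qprod q t = (1 - t) * qprod q (q * t)"
  using has_prod_unique[OF has_prod_ignore_initial_segment'[OF convergent_qprod, of t 1]]
  by (simp add: qprod_def mult_ac)

lemma qprod_eq_0D: "qprod q t = 0 \<Longrightarrow> \<exists>n. q ^ n * t = 1"
  using prodinf_nonzero[OF convergent_qprod, of t] unfolding qprod_def by fastforce

lemma qprod_nonzero_in_disc:
  assumes "norm t < 1"
  shows "qprod q t \<noteq> 0"
proof
  assume "qprod q t = 0"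
  then obtain n where "q ^ n * t = 1"
    using qprod_eq_0D by blast
  then have "norm (q ^ n) * norm t = 1"
    by (metis norm_mult norm_one)
  moreover have "norm (q ^ n) * norm t \<le> norm t"
    using q by (intro mult_left_le_one_le) (auto simp: norm_power power_le_one)
  ultimately show False
    using assms by simp
qed

text \<open>The factors satisfy the Weierstrass test on every disc of radius 1, with the bound
  \<open>|q|\<^sup>n (|t\<^sub>0| + 1)\<close> there.\<close>

lemma qprod_entire: "qprod q holomorphic_on UNIV"
proof (rule holomorphic_uniform_sequence[where f = "\<lambda>N t. \<Prod>n<N. 1 - q ^ n * t"])
  fix t0 :: complex
  have "uniformly_convergent_on (cball t0 1) (\<lambda>N t. \<Prod>n<N. 1 + - (q ^ n * t))"
  proof (rule uniformly_convergent_on_prod)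
    show "uniformly_convergent_on (cball t0 1) (\<lambda>N t. \<Sum>n<N. norm (- (q ^ n * t)))"
    proof (rule Weierstrass_m_test')
      fix n t assume "t \<in> cball t0 1"
      then have "norm t \<le> norm t0 + 1"
        using norm_triangle_ineq2[of t t0] by (simp add: dist_norm norm_minus_commute)
      then show "norm (norm (- (q ^ n * t))) \<le> norm (q ^ n) * (norm t0 + 1)"
        by (simp add: norm_mult mult_left_mono)
    next
      show "summable (\<lambda>n. norm (q ^ n) * (norm t0 + 1))"
        using q by (simp add: norm_power summable_mult2 summable_geometric)
    qed
  qed (auto intro!: continuous_intros)
  then obtain l where l: "uniform_limit (cball t0 1) (\<lambda>N t. \<Prod>n<N. 1 - q ^ n * t) l sequentially"
    by (auto simp: uniformly_convergent_on_def)
  have "l t = qprod q t" if "t \<in> cball t0 1" for t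
  proof (rule LIMSEQ_unique)
    show "(\<lambda>N. \<Prod>n<N. 1 - q ^ n * t) \<longlonglongrightarrow> l t"
      by (rule tendsto_uniform_limitI[OF l that])
    show "(\<lambda>N. \<Prod>n<N. 1 - q ^ n * t) \<longlonglongrightarrow> qprod q t"
      using prodinf_LIMSEQ_lessThan[OF summable_qprod[of t]] by (simp add: qprod_def)
  qed
  then have "uniform_limit (cball t0 1) (\<lambda>N t. \<Prod>n<N. 1 - q ^ n * t) (qprod q) sequentially"
    using l by (metis (mono_tags, lifting) uniform_limit_cong')
  then show "\<exists>d>0. cball t0 d \<subseteq> UNIV \<and>
      uniform_limit (cball t0 d) (\<lambda>N t. \<Prod>n<N. 1 - q ^ n * t) (qprod q) sequentially"
    by (intro exI[of _ 1]) auto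
qed (auto intro!: holomorphic_intros)

lemma holomorphic_qprod [holomorphic_intros]:
  "f holomorphic_on S \<Longrightarrow> (\<lambda>z. qprod q (f z)) holomorphic_on S"
  using holomorphic_on_compose[of f S "qprod q"] holomorphic_on_subset[OF qprod_entire]
  by (auto simp: o_def)

text \<open>Here all entries of \<open>A\<close> equal \<open>b\<close> and \<open>E\<close> has a geometric sequence on its diagonal.\<close>

lemma diagonal_tau_qprod:
  assumes "exp (p * b) = 1"
  shows "diagonal_tau p (\<lambda>z. qprod q (c * exp (2 * z * b)))"
  unfolding diagonal_tau_def
  by (intro exI[of _ "\<lambda>_. b"] exI[of _ "\<lambda>n. - (q ^ n * c)"])
     (use assms summable_qprod[of c] in \<open>auto simp: qprod_def mult_ac\<close>)

end

section \<open>Theta functions\<close>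

text \<open>The lattice is spanned by \<open>v\<close> and \<open>w\<close>; the theta functions below are invariant under \<open>v\<close>,
  and only quasi-periodic under \<open>w\<close>.\<close>

locale normalized_lattice =
  fixes v w :: complex
  assumes Im_pos: "Im (w / v) > 0"
begin

lemma v_nonzero: "v \<noteq> 0"
  using Im_pos by auto

definition e :: "complex \<Rightarrow> complex" where "e z = exp (2 * of_real pi * \<i> * z / v)"
definition q :: complex where "q = e w"

lemma e_add: "e (x + y) = e x * e y"
  by (simp add: e_def distrib_left add_divide_distrib exp_add)

lemma e_zero [simp]: "e 0 = 1"
  by (simp add: e_def)

lemma e_nonzero [simp]: "e z \<noteq> 0"
  by (simp add: e_def)

lemma e_minus: "e (- z) = inverse (e z)"
  by (simp add: e_def exp_minus)

lemma e_diff: "e (x - y) = e x / e y"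
  using e_add[of x "- y"] by (simp add: e_minus divide_inverse)

lemma e_v [simp]: "e v = 1"
  using v_nonzero by (simp add: e_def exp_two_pi_i)

lemma e_of_nat_mult: "e (of_nat n * z) = e z ^ n"
  by (induction n) (simp_all add: distrib_right e_add)

lemma e_eq_1D:
  assumes "e z = 1"
  shows "\<exists>m. z = of_int m * v"
proof -
  obtain m where "2 * of_real pi * \<i> * z / v = of_int (2 * m) * of_real pi * \<i>"
    using assms exp_eq[of "2 * of_real pi * \<i> * z / v" 0] by (auto simp: e_def)
  then have "z = of_int m * v"
    using v_nonzero by (simp add: field_simps)
  then show ?thesis by blast
qed

lemma norm_e: "norm (e (of_real r * w)) = exp (- 2 * pi * r * Im (w / v))"
proof -
  have "2 * of_real pi * \<i> * (of_real r * w) / v = of_real (2 * pi * r) * (\<i> * (w / v))"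
    by simp
  moreover have "Re (of_real x * y) = x * Re y" for x y
    by simp
  ultimately show ?thesis
    by (simp only: e_def norm_exp_eq_Re) (simp only: Re_i_times, simp)
qed

lemma norm_q: "norm q < 1"
  using norm_e[of 1] Im_pos by (simp add: q_def)

lemmas qprod_rules = qprod_shift[OF norm_q] qprod_eq_0D[OF norm_q] qprod_nonzero_in_disc[OF norm_q]

definition lattice :: "complex set" where
  "lattice = {of_int m * v + of_int n * w | m n. True}"

lemma lattice_diff: "x \<in> lattice \<Longrightarrow> y \<in> lattice \<Longrightarrow> x - y \<in> lattice"
  unfolding lattice_def
proof clarify
  fix m n m' n' :: int
  show "\<exists>k l. of_int m * v + of_int n * w - (of_int m' * v + of_int n' * w) = of_int k * v + of_int l * w \<and> True"
    by (intro exI[of _ "m - m'"] exI[of _ "n - n'"]) (simp add: algebra_simps)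
qed

lemma zero_in_lattice: "0 \<in> lattice"
  unfolding lattice_def by (rule CollectI, intro exI[of _ 0]) simp

lemma lattice_minus: "x \<in> lattice \<Longrightarrow> - x \<in> lattice"
  using lattice_diff[OF zero_in_lattice] by simp

lemma lattice_add: "x \<in> lattice \<Longrightarrow> y \<in> lattice \<Longrightarrow> x + y \<in> lattice"
  using lattice_diff[OF _ lattice_minus] by fastforce

lemma lattice_induct:
  assumes "l \<in> lattice" "P v" "P w"
    and add: "\<And>x y. P x \<Longrightarrow> P y \<Longrightarrow> P (x + y)"
    and minus: "\<And>x. P x \<Longrightarrow> P (- x)"
  shows "P l"
proof -
  have zero: "P 0"
    using add[OF assms(2) minus[OF assms(2)]] by simp
  have nat: "P (of_nat k * x)" if "P x" for k x
    by (induction k) (simp_all add: zero distrib_right add that)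
  have int: "P (of_int m * x)" if "P x" for m x
    by (cases m) (use nat[OF that] minus in \<open>auto simp: minus_mult_left[symmetric] simp del: of_nat_Suc\<close>)
  show ?thesis
    using assms(1) by (auto simp: lattice_def intro!: add int assms(2,3))
qed

text \<open>Up to a factor \<open>exp (\<alpha> * z + \<beta>)\<close> and a translation, this is Jacobi's theta function in the product
  form given by the triple product identity. The two factors have their zeros on the two halves of
  \<open>a + \<int>v + \<int>w\<close>.\<close>

definition theta :: "complex \<Rightarrow> complex \<Rightarrow> complex" where
  "theta a z = qprod q (e (z - a)) * qprod q (q * e (a - z))"

lemma theta_v: "theta a (z + v) = theta a z"
  by (simp add: theta_def e_add e_diff)

text \<open>The shift by \<open>w\<close> multiplies the argument of the first factor by \<open>q\<close> and divides that of the
  second by \<open>q\<close>: one factor \<open>1 - e (z - a)\<close> is lost and one factor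
  \<open>1 - e (a - z) = - e (a - z) * (1 - e (z - a))\<close> is gained.\<close>

lemma theta_w: "theta a (z + w) = - e (a - z) * theta a z"
proof -
  have "theta a (z + w) = qprod q (q * e (z - a)) * qprod q (e (a - z))"
    by (simp add: theta_def e_add e_diff q_def mult.commute)
  also have "qprod q (e (a - z)) = (1 - e (a - z)) * qprod q (q * e (a - z))"
    by (rule qprod_rules)
  also have "1 - e (a - z) = - e (a - z) * (1 - e (z - a))"
    by (simp add: algebra_simps flip: e_add)
  finally show ?thesis
    using qprod_rules(1)[of "e (z - a)"] by (simp add: theta_def)
qed

lemma theta_translate: "theta (a + c) (z + c) = theta a z"
  by (simp add: theta_def algebra_simps)

lemma theta_zero_imp:
  assumes "theta a z = 0"
  shows "z - a \<in> lattice"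
proof -
  consider n where "q ^ n * e (z - a) = 1" | n where "q ^ n * (q * e (a - z)) = 1"
    using assms qprod_rules(2) unfolding theta_def by (metis mult_eq_0_iff)
  then show ?thesis
  proof cases
    case (1 n)
    then have "e (of_nat n * w + (z - a)) = 1"
      by (simp add: e_add e_of_nat_mult q_def)
    then obtain m where "of_nat n * w + (z - a) = of_int m * v"
      using e_eq_1D by blast
    then have "z - a = of_int m * v + of_int (- int n) * w"
      by (simp add: algebra_simps)
    then show ?thesis unfolding lattice_def by blast
  next
    case (2 n)
    then have "e (of_nat (Suc n) * w + (a - z)) = 1"
      by (simp only: e_add e_of_nat_mult q_def[symmetric]) (simp add: mult_ac)
    then obtain m where "of_nat (Suc n) * w + (a - z) = of_int m * v"
      using e_eq_1D by blast
    then have "z - a = of_int (- m) * v + of_int (int (Suc n)) * w"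
      by (simp add: algebra_simps)
    then show ?thesis unfolding lattice_def by blast
  qed
qed

lemma theta_entire: "theta a holomorphic_on UNIV"
  unfolding theta_def e_def
  by (intro holomorphic_intros holomorphic_qprod norm_q) (use v_nonzero in auto)

lemma theta_analytic: "theta a analytic_on S"
  using theta_entire[of a] analytic_on_open[of UNIV "theta a"] analytic_on_subset by blast

text \<open>The midpoint \<open>a + w / 2\<close> is convenient because both factors are then evaluated at the same point
  \<open>e (w / 2)\<close>, a square root of \<open>q\<close>, inside the unit disc.\<close>

lemma theta_not_identically_zero: "theta a (a + w / 2) \<noteq> 0"
proof -
  have "norm (e (w / 2)) < 1"
    using norm_e[of "1/2"] Im_pos by simp
  moreover have "q * e (- (w / 2)) = e (w / 2)"
    unfolding q_def e_add[symmetric] by simp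
  ultimately show ?thesis
    using qprod_rules(3)[of "e (w / 2)"] by (simp add: theta_def)
qed

lemma theta_eventually_nonzero: "\<forall>\<^sub>F u in at z. theta a u \<noteq> 0"
  using non_zero_neighbour_alt[OF theta_entire _ _ _ _ theta_not_identically_zero, of z a]
  by (auto elim: eventually_mono)

text \<open>Only the factor \<open>1 - e (z - a)\<close> vanishes at \<open>a\<close>, and its derivative there is \<open>- 2 \<pi> \<i> / v\<close>.\<close>

lemma zorder_theta_self: "zorder (theta a) a = 1"
proof (rule zorder_zero_eqI')
  show "theta a analytic_on {a}"
    by (rule theta_analytic)
  define g where "g z = qprod q (q * e (z - a)) * qprod q (q * e (a - z))" for z
  have theta_eq: "theta a = (\<lambda>z. (1 - e (z - a)) * g z)"
  proof
    fix z
    show "theta a z = (1 - e (z - a)) * g z"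
      using qprod_rules(1)[of "e (z - a)"] by (simp add: theta_def g_def)
  qed
  have "g holomorphic_on UNIV"
    unfolding g_def e_def
    by (intro holomorphic_intros holomorphic_qprod norm_q) (use v_nonzero in auto)
  then obtain g' where g': "(g has_field_derivative g') (at a)"
    using holomorphic_derivI[of g UNIV a] by auto
  have "((\<lambda>z. 1 - e (z - a)) has_field_derivative (- (2 * of_real pi * \<i> / v))) (at a)"
    unfolding e_def by (rule derivative_eq_intros refl | use v_nonzero in simp)+
  from DERIV_mult[OF this g']
  have "(theta a has_field_derivative - (2 * of_real pi * \<i> / v) * g a) (at a)"
    by (simp add: theta_eq)
  then have "deriv (theta a) a = - (2 * of_real pi * \<i> / v) * g a"
    by (rule DERIV_imp_deriv)
  moreover have "g a \<noteq> 0"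
    using qprod_rules(3)[OF norm_q] by (simp add: g_def)
  ultimately show "(deriv ^^ nat 1) (theta a) a \<noteq> 0"
    using v_nonzero by simp
  show "(deriv ^^ i) (theta a) a = 0" if "i < nat 1" for i
    using that by (simp add: theta_eq)
qed simp

text \<open>For fixed \<open>f\<close> the admissible \<open>l\<close> form a group, so it suffices to find the multipliers for the two
  basis vectors of the lattice.\<close>

definition third_kind_multiplier :: "(complex \<Rightarrow> complex) \<Rightarrow> complex \<Rightarrow> bool" where
  "third_kind_multiplier f l \<longleftrightarrow> (\<exists>\<alpha> \<beta>. \<forall>z. f (z + l) = exp (\<alpha> * z + \<beta>) * f z)"

lemma third_kind_multiplier_add:
  assumes "third_kind_multiplier f k" "third_kind_multiplier f l"
  shows "third_kind_multiplier f (k + l)"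
proof -
  obtain \<alpha> \<beta> \<gamma> \<delta> where "\<And>z. f (z + k) = exp (\<alpha> * z + \<beta>) * f z" "\<And>z. f (z + l) = exp (\<gamma> * z + \<delta>) * f z"
    using assms unfolding third_kind_multiplier_def by blast
  then have "f (z + (k + l)) = exp (\<gamma> * (z + k) + \<delta>) * exp (\<alpha> * z + \<beta>) * f z" for z
    unfolding add.assoc[symmetric, of z k l] by simp
  moreover have "exp (\<gamma> * (z + k) + \<delta>) * exp (\<alpha> * z + \<beta>)
      = exp ((\<gamma> + \<alpha>) * z + (\<gamma> * k + \<delta> + \<beta>))" for z
    unfolding exp_add[symmetric] by (simp add: algebra_simps)
  ultimately have "f (z + (k + l)) = exp ((\<gamma> + \<alpha>) * z + (\<gamma> * k + \<delta> + \<beta>)) * f z" for z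
    by simp
  then show ?thesis
    unfolding third_kind_multiplier_def by blast
qed

lemma third_kind_multiplier_minus:
  assumes "third_kind_multiplier f l"
  shows "third_kind_multiplier f (- l)"
proof -
  obtain \<alpha> \<beta> where f: "\<And>z. f (z + l) = exp (\<alpha> * z + \<beta>) * f z"
    using assms unfolding third_kind_multiplier_def by blast
  have "f (z + - l) = exp (- \<alpha> * z + (\<alpha> * l - \<beta>)) * f z" for z
  proof -
    have "exp (- \<alpha> * z + (\<alpha> * l - \<beta>)) * f z
            = exp (- \<alpha> * z + (\<alpha> * l - \<beta>)) * exp (\<alpha> * (z - l) + \<beta>) * f (z - l)"
      using f[of "z - l"] by simp
    also have "\<dots> = f (z - l)"
      unfolding exp_add[symmetric] by (simp add: algebra_simps)
    finally show ?thesis by simp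
  qed
  then show ?thesis
    unfolding third_kind_multiplier_def by blast
qed

lemma third_kind_multiplier_mult:
  assumes "third_kind_multiplier f l" "third_kind_multiplier g l"
  shows "third_kind_multiplier (\<lambda>z. f z * g z) l"
proof -
  obtain \<alpha> \<beta> \<gamma> \<delta> where "\<And>z. f (z + l) = exp (\<alpha> * z + \<beta>) * f z" "\<And>z. g (z + l) = exp (\<gamma> * z + \<delta>) * g z"
    using assms unfolding third_kind_multiplier_def by blast
  moreover have "exp ((\<alpha> + \<gamma>) * z + (\<beta> + \<delta>)) = exp (\<alpha> * z + \<beta>) * exp (\<gamma> * z + \<delta>)" for z
    unfolding exp_add[symmetric] by (simp add: algebra_simps)
  ultimately have "f (z + l) * g (z + l) = exp ((\<alpha> + \<gamma>) * z + (\<beta> + \<delta>)) * (f z * g z)" for z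
    by simp
  then show ?thesis
    unfolding third_kind_multiplier_def by blast
qed

lemma theta_third_kind:
  assumes "l \<in> lattice"
  shows "third_kind_multiplier (theta a) l"
  using assms
proof (rule lattice_induct)
  show "third_kind_multiplier (theta a) v"
    unfolding third_kind_multiplier_def
    by (intro exI[of _ 0]) (simp add: theta_v)
  have "- e (a - z) = exp (- (2 * of_real pi * \<i> / v) * z + (2 * of_real pi * \<i> * a / v + of_real pi * \<i>))" for z
  proof -
    have "exp (- (2 * of_real pi * \<i> / v) * z + (2 * of_real pi * \<i> * a / v + of_real pi * \<i>))
            = e (a - z) * exp (of_real pi * \<i>)"
      unfolding e_def exp_add[symmetric] by (simp add: diff_divide_distrib algebra_simps)
    then show ?thesis
      by simp
  qed
  then show "third_kind_multiplier (theta a) w"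
    unfolding third_kind_multiplier_def theta_w by metis
qed (simp_all add: third_kind_multiplier_add third_kind_multiplier_minus)

text \<open>At \<open>z = a + l\<close> the function \<open>theta z\<close> is a translate of \<open>theta a\<close> by a lattice vector, so it differs
  from \<open>theta a\<close> by a zero-free factor. This reduces every lattice translate of \<open>a\<close> to the point \<open>a\<close>.\<close>

lemma zorder_theta: "zorder (theta a) z = (if z - a \<in> lattice then 1 else 0)"
proof (cases "z - a \<in> lattice")
  case True
  obtain \<alpha> \<beta> where *: "\<And>u. theta a (u + (a - z)) = exp (\<alpha> * u + \<beta>) * theta a u"
    using theta_third_kind[OF lattice_minus[OF True], of a] unfolding third_kind_multiplier_def by auto
  have "theta z = (\<lambda>u. exp (\<alpha> * u + \<beta>) * theta a u)"
    using *[symmetric] theta_translate[of z "a - z"] by simp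
  then have "1 = zorder (\<lambda>u. exp (\<alpha> * u + \<beta>) * theta a u) z"
    using zorder_theta_self[of z] by simp
  also have "\<dots> = zorder (\<lambda>u. exp (\<alpha> * u + \<beta>)) z + zorder (theta a) z"
    by (intro zorder_times_analytic theta_analytic)
       (use theta_eventually_nonzero[of a z] in \<open>auto intro!: analytic_intros\<close>)
  also have "zorder (\<lambda>u. exp (\<alpha> * u + \<beta>)) z = 0"
    by (intro zorder_eq_0I analytic_intros) auto
  finally show ?thesis
    using True by simp
next
  case False
  then show ?thesis
    using theta_zero_imp by (auto intro!: zorder_eq_0I theta_analytic)
qed

text \<open>The two factors need diagonals \<open>A = \<pi> \<i> / v\<close> and \<open>A = - \<pi> \<i> / v\<close>. Because of the squared exponential
  in the tau function, half of the frequency of \<open>theta a\<close> appears here, so the group has the period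
  \<open>2 * v\<close> rather than \<open>v\<close>.\<close>

lemma diagonal_tau_theta: "diagonal_tau (2 * v) (theta a)"
proof -
  have *: "exp (2 * v * (of_real pi * \<i> / v)) = 1" "exp (2 * v * (- (of_real pi * \<i> / v))) = 1"
  proof -
    have "2 * v * (of_real pi * \<i> / v) = 2 * of_real pi * \<i>"
      using v_nonzero by simp
    then show "exp (2 * v * (of_real pi * \<i> / v)) = 1" "exp (2 * v * (- (of_real pi * \<i> / v))) = 1"
      by (simp_all only: mult_minus_right exp_minus exp_two_pi_i inverse_1)
  qed
  have "theta a = (\<lambda>z. qprod q (e (- a) * exp (2 * z * (of_real pi * \<i> / v)))
                  * qprod q (q * e a * exp (2 * z * (- (of_real pi * \<i> / v)))))"
    by (simp add: fun_eq_iff theta_def e_diff e_minus) (simp add: e_def exp_minus field_simps)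
  then show ?thesis
    using diagonal_tau_mult[OF diagonal_tau_qprod[OF norm_q *(1)] diagonal_tau_qprod[OF norm_q *(2)]]
    by simp
qed

end

section \<open>Divisors\<close>

text \<open>The notion of divisor asks for a nonzero value arbitrarily close to each point, which does not
  pass to products by itself; for meromorphic functions it is equivalent to being nonzero throughout
  a punctured neighbourhood, which does.\<close>

lemma meromorphic_frequently_imp_eventually_nonzero:
  assumes "f meromorphic_on UNIV" "\<exists>\<^sub>F w in at z. f w \<noteq> (0 :: complex)"
  shows "\<forall>\<^sub>F w in at z. f w \<noteq> 0"
proof (rule ccontr)
  assume "\<not> ?thesis"
  then have "\<exists>\<^sub>F w in at z. f w = 0"
    by (simp add: not_eventually)
  moreover have "f meromorphic_on {z}"
    using assms(1) meromorphic_on_subset by blast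
  ultimately have "\<forall>\<^sub>F w in at z. f w = 0"
    by (metis meromorphic_at_iff not_essential_frequently_0_imp_eventually_0)
  then show False
    using assms(2) by (simp add: frequently_def)
qed

lemma has_divisor_mult:
  assumes f: "has_divisor \<Lambda> f D" and g: "has_divisor \<Lambda> g D'"
  shows "has_divisor \<Lambda> (\<lambda>z. f z * g z) (D + D')"
  unfolding has_divisor_def
proof (intro conjI allI)
  have mero: "f meromorphic_on A" "g meromorphic_on A" for A
    using f g meromorphic_on_subset unfolding has_divisor_def by blast+
  then show "(\<lambda>z. f z * g z) meromorphic_on UNIV"
    by (intro meromorphic_intros)
  show "divisor_on \<Lambda> (D + D')"
    using f g keys_add[of D D'] unfolding has_divisor_def divisor_on_def by blast
  fix z
  have freq: "\<exists>\<^sub>F w in at z. f w \<noteq> 0" "\<exists>\<^sub>F w in at z. g w \<noteq> 0"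
    using f g by (simp_all add: has_divisor_def)
  have "\<forall>\<^sub>F w in at z. f w \<noteq> 0" "\<forall>\<^sub>F w in at z. g w \<noteq> 0"
    using meromorphic_frequently_imp_eventually_nonzero mero freq by blast+
  then have "\<forall>\<^sub>F w in at z. f w * g w \<noteq> 0"
    by eventually_elim simp
  then show "\<exists>\<^sub>F w in at z. f w * g w \<noteq> 0"
    by (rule eventually_frequently[OF at_neq_bot])
  show "zorder (\<lambda>z. f z * g z) z = Poly_Mapping.lookup (D + D') (torus_point \<Lambda> z)"
    using f g zorder_mult[OF mero(1) freq(1) mero(2) freq(2)] by (simp add: has_divisor_def lookup_add)
qed

lemma has_divisor_divide:
  assumes f: "has_divisor \<Lambda> f D" and g: "has_divisor \<Lambda> g D'"
  shows "has_divisor \<Lambda> (\<lambda>z. f z / g z) (D - D')"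
  unfolding has_divisor_def
proof (intro conjI allI)
  have mero: "f meromorphic_on A" "g meromorphic_on A" for A
    using f g meromorphic_on_subset unfolding has_divisor_def by blast+
  then show "(\<lambda>z. f z / g z) meromorphic_on UNIV"
    by (intro meromorphic_intros)
  show "divisor_on \<Lambda> (D - D')"
    using f g keys_diff[of D D'] unfolding has_divisor_def divisor_on_def by blast
  fix z
  have freq: "\<exists>\<^sub>F w in at z. f w \<noteq> 0" "\<exists>\<^sub>F w in at z. g w \<noteq> 0"
    using f g by (simp_all add: has_divisor_def)
  have "\<forall>\<^sub>F w in at z. f w \<noteq> 0" "\<forall>\<^sub>F w in at z. g w \<noteq> 0"
    using meromorphic_frequently_imp_eventually_nonzero mero freq by blast+
  then have "\<forall>\<^sub>F w in at z. f w / g w \<noteq> 0"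
    by eventually_elim simp
  then show "\<exists>\<^sub>F w in at z. f w / g w \<noteq> 0"
    by (rule eventually_frequently[OF at_neq_bot])
  show "zorder (\<lambda>z. f z / g z) z = Poly_Mapping.lookup (D - D') (torus_point \<Lambda> z)"
    using f g zorder_divide[OF mero(1) freq(1) mero(2) freq(2)] by (simp add: has_divisor_def lookup_minus)
qed

definition point_divisor :: "complex set \<Rightarrow> complex list \<Rightarrow> complex set \<Rightarrow>\<^sub>0 int" where
  "point_divisor \<Lambda> xs = (\<Sum>x\<leftarrow>xs. frag_of (torus_point \<Lambda> x))"

lemma point_divisor_simps [simp]:
  "point_divisor \<Lambda> [] = 0"
  "point_divisor \<Lambda> (x # xs) = frag_of (torus_point \<Lambda> x) + point_divisor \<Lambda> xs"
  "point_divisor \<Lambda> (xs @ ys) = point_divisor \<Lambda> xs + point_divisor \<Lambda> ys"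
  by (simp_all add: point_divisor_def)

lemma point_divisor_replicate:
  "point_divisor \<Lambda> (replicate k x) = frag_cmul (int k) (frag_of (torus_point \<Lambda> x))"
  by (induction k) (simp_all add: frag_cmul_distrib)

text \<open>Induction on a set \<open>K\<close> that contains the support, which makes it possible to remove one point at a
  time together with its coefficient \<open>n\<close>: \<open>\<bar>n\<bar>\<close> copies of it join \<open>xs\<close> or \<open>ys\<close> according to the sign.
  A positive divisor never uses \<open>ys\<close>.\<close>

lemma divisor_eq_diff_point_divisors_aux:
  assumes "finite K" "K \<subseteq> range (torus_point \<Lambda>)" "Poly_Mapping.keys D \<subseteq> K"
  shows "\<exists>xs ys. D = point_divisor \<Lambda> xs - point_divisor \<Lambda> ys \<and>
           int (length xs) - int (length ys) = (\<Sum>p\<in>K. Poly_Mapping.lookup D p) \<and>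
           (positive_divisor D \<longrightarrow> ys = [])"
  using assms
proof (induction K arbitrary: D rule: finite_induct)
  case empty
  then have "D = 0" by simp
  then show ?case
    by (intro exI[of _ "[]"]) simp
next
  case (insert p K)
  define n where "n = Poly_Mapping.lookup D p"
  define D' where "D' = D - frag_cmul n (frag_of p)"
  obtain x where x: "p = torus_point \<Lambda> x"
    using insert.prems by auto
  have lookup: "Poly_Mapping.lookup D' r = (if r = p then 0 else Poly_Mapping.lookup D r)" for r
    by (simp add: D'_def n_def lookup_minus)
  have "Poly_Mapping.keys D' \<subseteq> K"
    using insert.prems by (auto simp: in_keys_iff lookup split: if_splits)
  then obtain xs ys where IH: "D' = point_divisor \<Lambda> xs - point_divisor \<Lambda> ys"
      "int (length xs) - int (length ys) = (\<Sum>p\<in>K. Poly_Mapping.lookup D' p)"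
      "positive_divisor D' \<Longrightarrow> ys = []"
    using insert.IH[of D'] insert.prems by auto
  have D: "D = D' + frag_cmul n (frag_of (torus_point \<Lambda> x))"
    by (simp add: D'_def x)
  have deg: "int (length xs) - int (length ys) + n = (\<Sum>p\<in>insert p K. Poly_Mapping.lookup D p)"
    unfolding IH(2) using insert.hyps by (auto simp: lookup n_def intro!: sum.cong)
  have pos: "n \<ge> 0 \<and> ys = []" if "positive_divisor D"
    using that IH(3) by (auto simp: positive_divisor_def lookup n_def)
  show ?case
  proof (cases "n \<ge> 0")
    case True
    have "D = point_divisor \<Lambda> (replicate (nat n) x @ xs) - point_divisor \<Lambda> ys"
      using D IH(1) True by (simp add: point_divisor_replicate)
    moreover have "int (length (replicate (nat n) x @ xs)) - int (length ys)
                     = (\<Sum>p\<in>insert p K. Poly_Mapping.lookup D p)"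
      using deg True by simp
    ultimately show ?thesis
      using pos by blast
  next
    case False
    have "D = point_divisor \<Lambda> xs - point_divisor \<Lambda> (replicate (nat (- n)) x @ ys)"
      using D IH(1) False by (simp add: point_divisor_replicate minus_frag_cmul[symmetric] del: minus_frag_cmul)
    moreover have "int (length xs) - int (length (replicate (nat (- n)) x @ ys))
                     = (\<Sum>p\<in>insert p K. Poly_Mapping.lookup D p)"
      using deg False by simp
    ultimately show ?thesis
      using pos False by blast
  qed
qed

lemma divisor_eq_diff_point_divisors:
  assumes "divisor_on \<Lambda> D"
  obtains xs ys where "D = point_divisor \<Lambda> xs - point_divisor \<Lambda> ys"
    "int (length xs) - int (length ys) = degree_divisor D"
    "positive_divisor D \<Longrightarrow> ys = []"
  using divisor_eq_diff_point_divisors_aux[of "Poly_Mapping.keys D" \<Lambda> D] assms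
  unfolding divisor_on_def degree_divisor_def by auto

section \<open>Products and quotients of theta functions\<close>

context normalized_lattice
begin

lemma torus_point_eq_iff: "torus_point lattice a = torus_point lattice b \<longleftrightarrow> a - b \<in> lattice"
proof
  assume "torus_point lattice a = torus_point lattice b"
  moreover have "a \<in> torus_point lattice a"
    using zero_in_lattice by (force simp: torus_point_def)
  ultimately show "a - b \<in> lattice"
    by (auto simp: torus_point_def)
next
  have "torus_point lattice a \<subseteq> torus_point lattice b" if "a - b \<in> lattice" for a b
  proof
    fix z assume "z \<in> torus_point lattice a"
    then obtain l where l: "l \<in> lattice" "z = a + l"
      by (auto simp: torus_point_def)
    then have "z = b + (a - b + l)" "a - b + l \<in> lattice"
      using lattice_add[OF that] by simp_all
    then show "z \<in> torus_point lattice b"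
      unfolding torus_point_def by blast
  qed
  from this[of a b] this[of b a] lattice_minus[of "a - b"]
  show "torus_point lattice a = torus_point lattice b" if "a - b \<in> lattice"
    using that by auto
qed

lemma has_divisor_theta: "has_divisor lattice (theta a) (frag_of (torus_point lattice a))"
  unfolding has_divisor_def
proof (intro conjI allI)
  show "divisor_on lattice (frag_of (torus_point lattice a))"
    by (simp add: divisor_on_def)
  show "theta a meromorphic_on UNIV"
    by (intro analytic_on_imp_meromorphic_on theta_analytic)
  show "\<exists>\<^sub>F w in at z. theta a w \<noteq> 0" for z
    by (rule eventually_frequently[OF at_neq_bot theta_eventually_nonzero])
  show "zorder (theta a) z = Poly_Mapping.lookup (frag_of (torus_point lattice a)) (torus_point lattice z)" for z
    using torus_point_eq_iff[of z a] by (auto simp: zorder_theta)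
qed

definition theta_product :: "complex list \<Rightarrow> complex \<Rightarrow> complex" where
  "theta_product xs z = (\<Prod>a\<leftarrow>xs. theta a z)"

lemma theta_product_Nil: "theta_product [] = (\<lambda>_. 1)"
  by (simp add: theta_product_def fun_eq_iff)

lemma theta_product_Cons: "theta_product (a # xs) = (\<lambda>z. theta a z * theta_product xs z)"
  by (simp add: theta_product_def fun_eq_iff)

lemma has_divisor_theta_product: "has_divisor lattice (theta_product xs) (point_divisor lattice xs)"
proof (induction xs)
  case Nil
  have "has_divisor lattice (\<lambda>_. 1) 0"
    by (auto simp: has_divisor_def divisor_on_def intro!: meromorphic_intros)
  then show ?case
    by (simp add: theta_product_Nil)
qed (simp add: theta_product_Cons has_divisor_mult has_divisor_theta)

lemma diagonal_tau_theta_product: "diagonal_tau (2 * v) (theta_product xs)"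
  by (induction xs)
     (simp_all add: theta_product_Nil theta_product_Cons diagonal_tau_one diagonal_tau_mult diagonal_tau_theta)

lemma theta_product_third_kind:
  assumes "l \<in> lattice"
  shows "third_kind_multiplier (theta_product xs) l"
proof (induction xs)
  case Nil
  show ?case
    unfolding third_kind_multiplier_def theta_product_Nil by (intro exI[of _ 0]) simp
qed (simp add: theta_product_Cons third_kind_multiplier_mult theta_third_kind assms)

lemma theta_product_v: "theta_product xs (z + v) = theta_product xs z"
  by (simp add: theta_product_def theta_v)

lemma theta_product_w:
  "theta_product xs (z + w) = (- e (- z)) ^ length xs * e (sum_list xs) * theta_product xs z"
proof (induction xs)
  case (Cons a xs)
  have "e (a - z) = e a * e (- z)"
    by (simp flip: e_add)
  then show ?case
    using Cons.IH by (simp add: theta_product_Cons theta_w e_add)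
qed (simp add: theta_product_Nil)

text \<open>At the zeros of the denominator this takes the value 0. These zeros form a set that is invariant
  under the lattice, so the equations for lattice translations hold at these points, too.\<close>

definition theta_quotient :: "complex list \<Rightarrow> complex list \<Rightarrow> complex \<Rightarrow> complex" where
  "theta_quotient xs ys z = theta_product xs z / theta_product ys z"

lemma has_divisor_theta_quotient:
  "has_divisor lattice (theta_quotient xs ys) (point_divisor lattice xs - point_divisor lattice ys)"
  unfolding theta_quotient_def[abs_def] by (intro has_divisor_divide has_divisor_theta_product)

lemma theta_quotient_v: "theta_quotient xs ys (z + v) = theta_quotient xs ys z"
  by (simp add: theta_quotient_def theta_product_v)

text \<open>The factors \<open>(- e (- z)) ^ length xs\<close> of numerator and denominator cancel; what remains does not
  depend on \<open>z\<close>, and it is 1 if the sums of zeros and poles coincide.\<close>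

lemma theta_quotient_w:
  assumes "length xs = length ys"
  shows "theta_quotient xs ys (z + w) = e (sum_list xs - sum_list ys) * theta_quotient xs ys z"
  by (simp add: theta_quotient_def theta_product_w assms e_diff)

lemma theta_quotient_second_kind:
  assumes "length xs = length ys" "l \<in> lattice"
  shows "\<exists>\<rho>. \<rho> \<noteq> 0 \<and> (\<forall>z. theta_quotient xs ys (z + l) = \<rho> * theta_quotient xs ys z)"
  using assms(2)
proof (rule lattice_induct)
  let ?f = "theta_quotient xs ys" 
  show "\<exists>\<rho>. \<rho> \<noteq> 0 \<and> (\<forall>z. ?f (z + v) = \<rho> * ?f z)"
    by (intro exI[of _ 1]) (simp add: theta_quotient_v)
  show "\<exists>\<rho>. \<rho> \<noteq> 0 \<and> (\<forall>z. ?f (z + w) = \<rho> * ?f z)"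
    using theta_quotient_w[OF assms(1)] e_nonzero by blast
next
  let ?f = "theta_quotient xs ys" 
  fix x y
  assume "\<exists>\<rho>. \<rho> \<noteq> 0 \<and> (\<forall>z. ?f (z + x) = \<rho> * ?f z)" "\<exists>\<rho>. \<rho> \<noteq> 0 \<and> (\<forall>z. ?f (z + y) = \<rho> * ?f z)"
  then obtain \<rho> \<sigma> where "\<rho> \<noteq> 0" "\<sigma> \<noteq> 0" "\<And>z. ?f (z + x) = \<rho> * ?f z" "\<And>z. ?f (z + y) = \<sigma> * ?f z"
    by blast
  then have "\<sigma> * \<rho> \<noteq> 0" "?f (z + (x + y)) = \<sigma> * \<rho> * ?f z" for z
    by (simp_all add: add.assoc[symmetric])
  then show "\<exists>\<rho>. \<rho> \<noteq> 0 \<and> (\<forall>z. ?f (z + (x + y)) = \<rho> * ?f z)"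
    by blast
next
  let ?f = "theta_quotient xs ys" 
  fix x
  assume "\<exists>\<rho>. \<rho> \<noteq> 0 \<and> (\<forall>z. ?f (z + x) = \<rho> * ?f z)"
  then obtain \<rho> where \<rho>: "\<rho> \<noteq> 0" "\<And>z. ?f (z + x) = \<rho> * ?f z"
    by blast
  have "?f (z + - x) = inverse \<rho> * ?f z" for z
    using \<rho>(2)[of "z - x"] \<rho>(1) by (simp add: field_simps)
  then show "\<exists>\<rho>. \<rho> \<noteq> 0 \<and> (\<forall>z. ?f (z + - x) = \<rho> * ?f z)"
    using \<rho>(1) by (intro exI[of _ "inverse \<rho>"]) simp
qed

lemma theta_quotient_first_kind:
  assumes "length xs = length ys" "sum_list xs = sum_list ys" "l \<in> lattice"
  shows "\<forall>z. theta_quotient xs ys (z + l) = theta_quotient xs ys z"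
  using assms(3)
proof (rule lattice_induct)
  let ?f = "theta_quotient xs ys" 
  show "\<forall>z. ?f (z + v) = ?f z"
    by (simp add: theta_quotient_v)
  show "\<forall>z. ?f (z + w) = ?f z"
    using theta_quotient_w[OF assms(1)] assms(2) by simp
  show "\<forall>z. ?f (z + (x + y)) = ?f z" if "\<forall>z. ?f (z + x) = ?f z" "\<forall>z. ?f (z + y) = ?f z" for x y
    using that by (simp add: add.assoc[symmetric])
  show "\<forall>z. ?f (z + - x) = ?f z" if "\<forall>z. ?f (z + x) = ?f z" for x
    using that by (metis diff_add_cancel diff_conv_add_uminus)
qed

lemma exists_system_theta_product:
  assumes "2 * v \<in> \<Omega>"
  shows "\<exists>(A :: ell2 \<Rightarrow> ell2) (B :: ell2 \<Rightarrow> ell2) (C :: ell2 \<Rightarrow> ell2) (E :: ell2 \<Rightarrow> ell2).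
           uniformly_periodic_system \<Omega> A B C E \<and> tau A E = theta_product xs"
  by (rule exists_uniformly_periodic_system[OF diagonal_tau_theta_product assms]) (simp add: v_nonzero)

end

section \<open>Realization of elliptic functions as tau functions\<close>

text \<open>The period \<open>2 * v\<close> has to be real as soon as the lattice contains some real \<open>r \<noteq> 0\<close>. Dividing the
  coordinates of \<open>r\<close> by their gcd gives a primitive real lattice vector \<open>v\<close>, and the Bezout
  coefficients complete it to a basis with determinant 1, which therefore keeps the orientation.\<close>

lemma exists_adapted_basis:
  fixes \<omega>\<^sub>1 \<omega>\<^sub>2 :: complex
  assumes "\<omega>\<^sub>1 \<noteq> 0" "Im (\<omega>\<^sub>2 / \<omega>\<^sub>1) > 0"
  obtains v w where "Im (w / v) > 0"
    "period_lattice \<omega>\<^sub>1 \<omega>\<^sub>2 = {of_int m * v + of_int n * w | m n. True}"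
    "2 * v \<in> admissible_periods (period_lattice \<omega>\<^sub>1 \<omega>\<^sub>2)"
proof (cases "\<exists>r\<in>period_lattice \<omega>\<^sub>1 \<omega>\<^sub>2 \<inter> \<real>. r \<noteq> 0")
  case False
  show ?thesis
  proof (rule that[of "2 * \<omega>\<^sub>2" "2 * \<omega>\<^sub>1"])
    show "2 * (2 * \<omega>\<^sub>1) \<in> admissible_periods (period_lattice \<omega>\<^sub>1 \<omega>\<^sub>2)"
      unfolding admissible_periods_def if_not_P[OF False] by simp
  qed (use assms in \<open>auto simp: period_lattice_def\<close>)
next
  case True
  then obtain r m n where r: "r \<in> \<real>" "r \<noteq> 0" "r = of_int m * (2 * \<omega>\<^sub>1) + of_int n * (2 * \<omega>\<^sub>2)"
    by (auto simp: period_lattice_def)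
  define g where "g = gcd m n"
  have g: "g \<noteq> 0"
    using r by (auto simp: g_def)
  define k where "k = m div g"
  define l where "l = n div g"
  have mn: "m = g * k" "n = g * l"
    by (simp_all add: k_def l_def g_def)
  have "coprime k l"
    using g unfolding k_def l_def g_def by (intro div_gcd_coprime) auto
  then obtain s t where st: "s * k + t * l = 1"
    using bezout_int[of k l] by (auto simp: coprime_iff_gcd_eq_1)
  define v where "v = of_int k * (2 * \<omega>\<^sub>1) + of_int l * (2 * \<omega>\<^sub>2)"
  define w where "w = of_int (- t) * (2 * \<omega>\<^sub>1) + of_int s * (2 * \<omega>\<^sub>2)"
  have r_eq: "r = of_int g * v"
    by (simp add: r(3) v_def mn algebra_simps)
  have v: "v \<noteq> 0" "v \<in> \<real>"
  proof -
    show "v \<noteq> 0" using r r_eq by auto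
    have "v = r / of_int g" using r_eq g by simp
    then show "v \<in> \<real>" using r(1) by simp
  qed
  have basis: "2 * \<omega>\<^sub>1 = of_int s * v - of_int l * w" "2 * \<omega>\<^sub>2 = of_int t * v + of_int k * w"
  proof -
    have st': "of_int s * of_int k + of_int t * of_int l = (1 :: complex)"
      using arg_cong[OF st, of "of_int :: int \<Rightarrow> complex"] by simp
    have "of_int s * v - of_int l * w = (of_int s * of_int k + of_int t * of_int l) * (2 * \<omega>\<^sub>1)"
      by (simp add: v_def w_def algebra_simps)
    then show "2 * \<omega>\<^sub>1 = of_int s * v - of_int l * w" using st' by simp
    have "of_int t * v + of_int k * w = (of_int s * of_int k + of_int t * of_int l) * (2 * \<omega>\<^sub>2)"
      by (simp add: v_def w_def algebra_simps)
    then show "2 * \<omega>\<^sub>2 = of_int t * v + of_int k * w" using st' by simp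
  qed
  show ?thesis
  proof (rule that[of w v])
    define \<kappa> where "\<kappa> = \<omega>\<^sub>2 / \<omega>\<^sub>1"
    define a b where "a = of_int k + of_int l * \<kappa>" and "b = of_int (- t) + of_int s * \<kappa>"
    have eq: "v = 2 * \<omega>\<^sub>1 * a" "w = 2 * \<omega>\<^sub>1 * b"
      using assms(1) by (simp_all add: v_def w_def a_def b_def \<kappa>_def field_simps)
    have "a \<noteq> 0"
      using v eq by auto
    then have pos: "0 < (Re a)\<^sup>2 + (Im a)\<^sup>2"
      by (simp add: complex_neq_0)
    have "Im (w / v) = Im (b / a)"
      using assms(1) by (simp add: eq)
    also have "\<dots> = (Im b * Re a - Re b * Im a) / ((Re a)\<^sup>2 + (Im a)\<^sup>2)"
      by (rule Im_divide)
    also have "Im b * Re a - Re b * Im a = of_int (s * k + t * l) * Im \<kappa>"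
      by (simp add: a_def b_def algebra_simps)
    finally show "Im (w / v) > 0"
      using pos assms(2) st by (simp add: \<kappa>_def)
    show "period_lattice \<omega>\<^sub>1 \<omega>\<^sub>2 = {of_int m * v + of_int n * w | m n. True}"
    proof (intro equalityI subsetI)
      fix z assume "z \<in> period_lattice \<omega>\<^sub>1 \<omega>\<^sub>2"
      then obtain i j where "z = of_int i * (2 * \<omega>\<^sub>1) + of_int j * (2 * \<omega>\<^sub>2)"
        by (auto simp: period_lattice_def)
      then have "z = of_int (i * s + j * t) * v + of_int (j * k - i * l) * w"
        unfolding basis by (simp add: algebra_simps)
      then show "z \<in> {of_int m * v + of_int n * w | m n. True}" by blast
    next
      fix z assume "z \<in> {of_int m * v + of_int n * w | m n. True}"
      then obtain i j where "z = of_int i * v + of_int j * w" by blast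
      then have "z = of_int (i * k - j * t) * (2 * \<omega>\<^sub>1) + of_int (i * l + j * s) * (2 * \<omega>\<^sub>2)"
        by (simp add: v_def w_def algebra_simps)
      then show "z \<in> period_lattice \<omega>\<^sub>1 \<omega>\<^sub>2"
        unfolding period_lattice_def by blast
    qed
    show "2 * v \<in> admissible_periods (period_lattice \<omega>\<^sub>1 \<omega>\<^sub>2)"
      unfolding admissible_periods_def if_P[OF True] using v by simp
  qed
qed

theorem lemma7p1:
  fixes \<omega>\<^sub>1 \<omega>\<^sub>2 :: complex and \<Lambda> \<Omega> :: "complex set"
  assumes "\<omega>\<^sub>1 \<noteq> 0" and "\<omega>\<^sub>2 \<noteq> 0" and "Im (\<omega>\<^sub>2 / \<omega>\<^sub>1) > 0"
    and "\<Lambda> = period_lattice \<omega>\<^sub>1 \<omega>\<^sub>2"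
    and "\<Omega> = admissible_periods \<Lambda>"
  shows
    "(\<forall>\<delta>. divisor_on \<Lambda> \<delta> \<and> positive_divisor \<delta> \<longrightarrow>
        (\<exists>(A :: ell2 \<Rightarrow> ell2) (B :: ell2 \<Rightarrow> ell2) (C :: ell2 \<Rightarrow> ell2) (E :: ell2 \<Rightarrow> ell2).
           uniformly_periodic_system \<Omega> A B C E \<and>
           elliptic_third_kind \<omega>\<^sub>1 \<omega>\<^sub>2 (tau A E) \<and>
           has_divisor \<Lambda> (tau A E) \<delta>)) \<and>
     (\<forall>\<eta>. divisor_on \<Lambda> \<eta> \<and> degree_divisor \<eta> = 0 \<longrightarrow>
        (\<exists>(A\<^sub>0 :: ell2 \<Rightarrow> ell2) (B\<^sub>0 :: ell2 \<Rightarrow> ell2) (C\<^sub>0 :: ell2 \<Rightarrow> ell2) (E\<^sub>0 :: ell2 \<Rightarrow> ell2)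
          (A\<^sub>1 :: ell2 \<Rightarrow> ell2) (B\<^sub>1 :: ell2 \<Rightarrow> ell2) (C\<^sub>1 :: ell2 \<Rightarrow> ell2) (E\<^sub>1 :: ell2 \<Rightarrow> ell2).
           uniformly_periodic_system \<Omega> A\<^sub>0 B\<^sub>0 C\<^sub>0 E\<^sub>0 \<and>
           uniformly_periodic_system \<Omega> A\<^sub>1 B\<^sub>1 C\<^sub>1 E\<^sub>1 \<and>
           elliptic_second_kind \<omega>\<^sub>1 \<omega>\<^sub>2 (\<lambda>z. tau A\<^sub>1 E\<^sub>1 z / tau A\<^sub>0 E\<^sub>0 z) \<and>
           has_divisor \<Lambda> (\<lambda>z. tau A\<^sub>1 E\<^sub>1 z / tau A\<^sub>0 E\<^sub>0 z) \<eta>)) \<and>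
     (\<forall>(n :: nat) (a :: nat \<Rightarrow> complex) (b :: nat \<Rightarrow> complex).
        (\<Sum>j=1..n. a j - b j) \<in> \<Lambda> \<longrightarrow>
        (\<exists>(A\<^sub>0 :: ell2 \<Rightarrow> ell2) (B\<^sub>0 :: ell2 \<Rightarrow> ell2) (C\<^sub>0 :: ell2 \<Rightarrow> ell2) (E\<^sub>0 :: ell2 \<Rightarrow> ell2)
          (A\<^sub>1 :: ell2 \<Rightarrow> ell2) (B\<^sub>1 :: ell2 \<Rightarrow> ell2) (C\<^sub>1 :: ell2 \<Rightarrow> ell2) (E\<^sub>1 :: ell2 \<Rightarrow> ell2).
           uniformly_periodic_system \<Omega> A\<^sub>0 B\<^sub>0 C\<^sub>0 E\<^sub>0 \<and>
           uniformly_periodic_system \<Omega> A\<^sub>1 B\<^sub>1 C\<^sub>1 E\<^sub>1 \<and>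
           elliptic_first_kind \<omega>\<^sub>1 \<omega>\<^sub>2 (\<lambda>z. tau A\<^sub>1 E\<^sub>1 z / tau A\<^sub>0 E\<^sub>0 z) \<and>
           has_divisor \<Lambda> (\<lambda>z. tau A\<^sub>1 E\<^sub>1 z / tau A\<^sub>0 E\<^sub>0 z)
             ((\<Sum>j=1..n. frag_of (torus_point \<Lambda> (a j))) - (\<Sum>j=1..n. frag_of (torus_point \<Lambda> (b j))))))"
proof -
  obtain v w where vw: "Im (w / v) > 0"
    "period_lattice \<omega>\<^sub>1 \<omega>\<^sub>2 = {of_int m * v + of_int n * w | m n. True}"
    "2 * v \<in> admissible_periods (period_lattice \<omega>\<^sub>1 \<omega>\<^sub>2)"
    using exists_adapted_basis[OF assms(1,3)] by blast
  interpret normalized_lattice v w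
    by standard (rule vw(1))
  have \<Lambda>: "\<Lambda> = lattice"
    using vw(2) assms(4) by (simp add: lattice_def)
  have "2 * v \<in> \<Omega>"
    using vw(3) assms(4,5) by simp
  note system = exists_system_theta_product[OF this]
  have half_periods: "2 * \<omega> \<in> lattice" if "\<omega> \<in> {\<omega>\<^sub>1, \<omega>\<^sub>2}" for \<omega>
  proof -
    have "2 * \<omega>\<^sub>1 = of_int 1 * (2 * \<omega>\<^sub>1) + of_int 0 * (2 * \<omega>\<^sub>2)"
      "2 * \<omega>\<^sub>2 = of_int 0 * (2 * \<omega>\<^sub>1) + of_int 1 * (2 * \<omega>\<^sub>2)"
      by simp_all
    then show ?thesis
      using that unfolding \<Lambda>[symmetric] assms(4) period_lattice_def by blast
  qed
  have pair: "\<exists>(A\<^sub>0 :: ell2 \<Rightarrow> ell2) (B\<^sub>0 :: ell2 \<Rightarrow> ell2) (C\<^sub>0 :: ell2 \<Rightarrow> ell2) (E\<^sub>0 :: ell2 \<Rightarrow> ell2)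
          (A\<^sub>1 :: ell2 \<Rightarrow> ell2) (B\<^sub>1 :: ell2 \<Rightarrow> ell2) (C\<^sub>1 :: ell2 \<Rightarrow> ell2) (E\<^sub>1 :: ell2 \<Rightarrow> ell2).
           uniformly_periodic_system \<Omega> A\<^sub>0 B\<^sub>0 C\<^sub>0 E\<^sub>0 \<and>
           uniformly_periodic_system \<Omega> A\<^sub>1 B\<^sub>1 C\<^sub>1 E\<^sub>1 \<and>
           P (\<lambda>z. tau A\<^sub>1 E\<^sub>1 z / tau A\<^sub>0 E\<^sub>0 z) \<and>
           has_divisor \<Lambda> (\<lambda>z. tau A\<^sub>1 E\<^sub>1 z / tau A\<^sub>0 E\<^sub>0 z) D"
    if "P (theta_quotient xs ys)" "D = point_divisor lattice xs - point_divisor lattice ys" for P xs ys D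
  proof -
    obtain A0 B0 C0 E0 :: "ell2 \<Rightarrow> ell2" where
      0: "uniformly_periodic_system \<Omega> A0 B0 C0 E0" "tau A0 E0 = theta_product ys"
      using system[of ys] by blast
    obtain A1 B1 C1 E1 :: "ell2 \<Rightarrow> ell2" where
      1: "uniformly_periodic_system \<Omega> A1 B1 C1 E1" "tau A1 E1 = theta_product xs"
      using system[of xs] by blast
    have "(\<lambda>z. tau A1 E1 z / tau A0 E0 z) = theta_quotient xs ys"
      by (simp add: 0 1 theta_quotient_def fun_eq_iff)
    then show ?thesis
      using 0(1) 1(1) that has_divisor_theta_quotient unfolding \<Lambda> by metis
  qed
  show ?thesis
  proof (intro conjI allI impI; (elim conjE)?)
    fix \<delta> assume "divisor_on \<Lambda> \<delta>" "positive_divisor \<delta>"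
    then obtain xs where xs: "\<delta> = point_divisor lattice xs"
      using divisor_eq_diff_point_divisors[of \<Lambda> \<delta>] unfolding \<Lambda> by (metis diff_zero point_divisor_simps(1))
    obtain A B C E :: "ell2 \<Rightarrow> ell2" where
      sys: "uniformly_periodic_system \<Omega> A B C E" "tau A E = theta_product xs"
      using system[of xs] by blast
    have "elliptic_third_kind \<omega>\<^sub>1 \<omega>\<^sub>2 (theta_product xs)"
      unfolding elliptic_third_kind_def
    proof (intro conjI ballI)
      show "theta_product xs meromorphic_on UNIV"
        using has_divisor_theta_product by (simp add: has_divisor_def)
      show "\<exists>a b. \<forall>\<^sub>\<approx>z. theta_product xs (z + 2 * \<omega>) = exp (a * z + b) * theta_product xs z"
        if "\<omega> \<in> {\<omega>\<^sub>1, \<omega>\<^sub>2}" for \<omega>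
        using theta_product_third_kind[OF half_periods[OF that], of xs]
        unfolding third_kind_multiplier_def by (meson always_eventually)
    qed
    then show "\<exists>(A :: ell2 \<Rightarrow> ell2) (B :: ell2 \<Rightarrow> ell2) (C :: ell2 \<Rightarrow> ell2) (E :: ell2 \<Rightarrow> ell2).
           uniformly_periodic_system \<Omega> A B C E \<and> elliptic_third_kind \<omega>\<^sub>1 \<omega>\<^sub>2 (tau A E) \<and>
           has_divisor \<Lambda> (tau A E) \<delta>"
      using sys has_divisor_theta_product[of xs] unfolding \<Lambda> xs by metis
  next
    fix \<eta> assume "divisor_on \<Lambda> \<eta>" "degree_divisor \<eta> = 0"
    then obtain xs ys where
      D: "\<eta> = point_divisor lattice xs - point_divisor lattice ys" and
      deg: "int (length xs) - int (length ys) = 0"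
      using divisor_eq_diff_point_divisors[of \<Lambda> \<eta>] unfolding \<Lambda> by metis
    then have len: "length xs = length ys"
      by simp
    have "elliptic_second_kind \<omega>\<^sub>1 \<omega>\<^sub>2 (theta_quotient xs ys)"
      unfolding elliptic_second_kind_def
    proof (intro conjI ballI)
      show "theta_quotient xs ys meromorphic_on UNIV"
        using has_divisor_theta_quotient by (simp add: has_divisor_def)
      show "\<exists>\<rho>. \<forall>\<^sub>\<approx>z. theta_quotient xs ys (z + 2 * \<omega>) = \<rho> * theta_quotient xs ys z"
        if "\<omega> \<in> {\<omega>\<^sub>1, \<omega>\<^sub>2}" for \<omega>
        using theta_quotient_second_kind[OF len half_periods[OF that]] by (meson always_eventually)
    qed
    from pair[of "elliptic_second_kind \<omega>\<^sub>1 \<omega>\<^sub>2", OF this D] show "\<exists>(A\<^sub>0 :: ell2 \<Rightarrow> ell2) (B\<^sub>0 :: ell2 \<Rightarrow> ell2)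
          (C\<^sub>0 :: ell2 \<Rightarrow> ell2) (E\<^sub>0 :: ell2 \<Rightarrow> ell2)
          (A\<^sub>1 :: ell2 \<Rightarrow> ell2) (B\<^sub>1 :: ell2 \<Rightarrow> ell2) (C\<^sub>1 :: ell2 \<Rightarrow> ell2) (E\<^sub>1 :: ell2 \<Rightarrow> ell2).
           uniformly_periodic_system \<Omega> A\<^sub>0 B\<^sub>0 C\<^sub>0 E\<^sub>0 \<and>
           uniformly_periodic_system \<Omega> A\<^sub>1 B\<^sub>1 C\<^sub>1 E\<^sub>1 \<and>
           elliptic_second_kind \<omega>\<^sub>1 \<omega>\<^sub>2 (\<lambda>z. tau A\<^sub>1 E\<^sub>1 z / tau A\<^sub>0 E\<^sub>0 z) \<and>
           has_divisor \<Lambda> (\<lambda>z. tau A\<^sub>1 E\<^sub>1 z / tau A\<^sub>0 E\<^sub>0 z) \<eta>" .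
  next
    fix n and a b :: "nat \<Rightarrow> complex"
    assume sum: "(\<Sum>j=1..n. a j - b j) \<in> \<Lambda>"
    define s where "s = (\<Sum>j=1..n. a j - b j)"
    \<comment> \<open>Another representative of the first point makes the sums agree exactly and not only modulo
      the lattice; for \<open>n = 0\<close> there is no point to change, but then both sums are 0 anyway.\<close>
    define a' where "a' j = (if j = 1 then a 1 - s else a j)" for j
    define xs where "xs = map a' [1..<Suc n]"
    define ys where "ys = map b [1..<Suc n]"
    have torus: "torus_point lattice (a' j) = torus_point lattice (a j)" for j
      using sum lattice_minus by (simp add: torus_point_eq_iff a'_def s_def \<Lambda> zero_in_lattice)
    have sum_eq: "sum_list xs = sum_list ys"
    proof (cases "n = 0")
      case False
      have "(\<Sum>j=1..n. a' j) = (\<Sum>j=1..n. a j - (if j = 1 then s else 0))"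
        by (intro sum.cong) (simp_all add: a'_def)
      also have "\<dots> = (\<Sum>j=1..n. a j) - s"
        using False by (simp add: sum_subtractf)
      also have "\<dots> = (\<Sum>j=1..n. b j)"
        by (simp add: s_def sum_subtractf)
      finally show ?thesis
        by (simp add: xs_def ys_def interv_sum_list_conv_sum_set_nat atLeastLessThanSuc_atLeastAtMost del: upt_Suc)
    qed (simp add: xs_def ys_def)
    have len: "length xs = length ys"
      by (simp add: xs_def ys_def)
    have "elliptic_first_kind \<omega>\<^sub>1 \<omega>\<^sub>2 (theta_quotient xs ys)"
      unfolding elliptic_first_kind_def
    proof (intro conjI ballI)
      show "theta_quotient xs ys meromorphic_on UNIV"
        using has_divisor_theta_quotient by (simp add: has_divisor_def)
      show "\<forall>\<^sub>\<approx>z. theta_quotient xs ys (z + 2 * \<omega>) = theta_quotient xs ys z"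
        if "\<omega> \<in> {\<omega>\<^sub>1, \<omega>\<^sub>2}" for \<omega>
        using theta_quotient_first_kind[OF len sum_eq half_periods[OF that]] by (rule always_eventually)
    qed
    moreover have "(\<Sum>j=1..n. frag_of (torus_point \<Lambda> (a j))) - (\<Sum>j=1..n. frag_of (torus_point \<Lambda> (b j)))
                     = point_divisor lattice xs - point_divisor lattice ys"
      by (simp add: point_divisor_def xs_def ys_def o_def torus \<Lambda> interv_sum_list_conv_sum_set_nat
            atLeastLessThanSuc_atLeastAtMost del: upt_Suc)
    ultimately show "\<exists>(A\<^sub>0 :: ell2 \<Rightarrow> ell2) (B\<^sub>0 :: ell2 \<Rightarrow> ell2) (C\<^sub>0 :: ell2 \<Rightarrow> ell2) (E\<^sub>0 :: ell2 \<Rightarrow> ell2)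
          (A\<^sub>1 :: ell2 \<Rightarrow> ell2) (B\<^sub>1 :: ell2 \<Rightarrow> ell2) (C\<^sub>1 :: ell2 \<Rightarrow> ell2) (E\<^sub>1 :: ell2 \<Rightarrow> ell2).
           uniformly_periodic_system \<Omega> A\<^sub>0 B\<^sub>0 C\<^sub>0 E\<^sub>0 \<and>
           uniformly_periodic_system \<Omega> A\<^sub>1 B\<^sub>1 C\<^sub>1 E\<^sub>1 \<and>
           elliptic_first_kind \<omega>\<^sub>1 \<omega>\<^sub>2 (\<lambda>z. tau A\<^sub>1 E\<^sub>1 z / tau A\<^sub>0 E\<^sub>0 z) \<and>
           has_divisor \<Lambda> (\<lambda>z. tau A\<^sub>1 E\<^sub>1 z / tau A\<^sub>0 E\<^sub>0 z)
             ((\<Sum>j=1..n. frag_of (torus_point \<Lambda> (a j))) - (\<Sum>j=1..n. frag_of (torus_point \<Lambda> (b j))))"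
      by (rule pair)
  qed
qed

end
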